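(* Let $\Psi$ be a quantum operation with respect to the Hilbert space $\mathcal{H}$ and let $A\in\mathcal{B}(\mathcal{H})$. The following assertions are equivalent: (i) $[R_A,\Psi]=0$. (ii) $A$ and $AA^*$ are constants of the discrete quantum semigroup $\{\Psi^n\}_{n\geq0}$. (iii) $[L_A,\Psi^\sharp]=0$. (iv) $A$ and $AA^*$ are fixed points of $\Psi^\sharp$.
   Context: $\mathcal{B}(\mathcal{H})$ is the algebra of bounded operators on $\mathcal{H}$ and $\mathcal{B}_1(\mathcal{H})$ the trace class. A quantum operation is a completely positive, trace-preserving linear map $\Psi\colon\mathcal{B}_1(\mathcal{H})\to\mathcal{B}_1(\mathcal{H})$; its dual $\Psi^\sharp\colon\mathcal{B}(\mathcal{H})\to\mathcal{B}(\mathcal{H})$ is defined by $\operatorname{tr}(\Psi(T)S)=\operatorname{tr}(T\Psi^\sharp(S))$ for $T\in\mathcal{B}_1(\mathcal{H})$, $S\in\mathcal{B}(\mathcal{H})$. $L_A(T)=AT$ and $R_A(T)=TA$, regarded as operators on $\mathcal{B}_1(\mathcal{H})$ or on $\mathcal{B}(\mathcal{H})$ according to context, and $[\Phi,\Psi]=\Phi\Psi-\Psi\Phi$. States (density operators) are the positive $\rho\in\mathcal{B}_1(\mathcal{H})$ with $\operatorname{tr}(\rho)=1$. An operator $B\in\mathcal{B}(\mathcal{H})$ is a constant of $\{\Psi^n\}_{n\ge0}$ if for every state $\rho$ the number $\operatorname{tr}(\Psi^n(\rho)B)$ does not depend on the integer $n\ge0$. *)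

theory Defs
  imports "HOL-Analysis.Analysis"
begin

text \<open>
  The inner product is conjugate-linear in the first argument.  Positive definiteness is part of
  \<open>cinner_self\<close>, and completeness comes from \<^class>\<open>banach\<close>.  No dimension or
  separability restriction is made.
\<close>

class complex_hilbert = banach +
  fixes scaleC :: "complex \<Rightarrow> 'a \<Rightarrow> 'a"  (infixr \<open>*\<^sub>C\<close> 75)
    and cinner :: "'a \<Rightarrow> 'a \<Rightarrow> complex"
  assumes scaleC_add_right: "a *\<^sub>C (x + y) = a *\<^sub>C x + a *\<^sub>C y"
    and scaleC_add_left: "(a + b) *\<^sub>C x = a *\<^sub>C x + b *\<^sub>C x"
    and scaleC_scaleC: "a *\<^sub>C (b *\<^sub>C x) = (a * b) *\<^sub>C x"
    and scaleC_of_real: "complex_of_real r *\<^sub>C x = r *\<^sub>R x"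
    and cinner_commute: "cinner x y = cnj (cinner y x)"
    and cinner_add_right: "cinner x (y + z) = cinner x y + cinner x z"
    and cinner_scaleC_right: "cinner x (a *\<^sub>C y) = a * cinner x y"
    and cinner_self: "cinner x x = complex_of_real ((norm x)\<^sup>2)"

lemma norm_scaleC: "norm (a *\<^sub>C x) = cmod a * norm (x :: 'a::complex_hilbert)"
proof -
  have "cinner (a *\<^sub>C x) (a *\<^sub>C x) = a * cnj a * cinner x x"
    by (metis cinner_commute cinner_scaleC_right complex_cnj_mult mult.assoc)
  hence "complex_of_real ((norm (a *\<^sub>C x))\<^sup>2) = complex_of_real ((cmod a * norm x)\<^sup>2)"
    by (simp add: cinner_self complex_norm_square power_mult_distrib flip: of_real_power)
  hence "(norm (a *\<^sub>C x))\<^sup>2 = (cmod a * norm x)\<^sup>2"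
    using of_real_eq_iff by blast
  thus ?thesis
    by (simp add: power2_eq_iff_nonneg)
qed

lemma bounded_linear_scaleC: "bounded_linear (\<lambda>x :: 'a::complex_hilbert. a *\<^sub>C x)"
proof (rule bounded_linear_intro[where K = "cmod a"])
  show "a *\<^sub>C (r *\<^sub>R x) = r *\<^sub>R (a *\<^sub>C x)" for r and x :: 'a
    by (simp add: scaleC_scaleC mult.commute flip: scaleC_of_real)
qed (simp_all add: scaleC_add_right norm_scaleC mult.commute)

text \<open>
  Elements of \<^typ>\<open>'a \<Rightarrow>\<^sub>L 'a\<close> are only real-linear, so the algebra of bounded operators of the
  complex Hilbert space is the following subset.
\<close>

definition bounded_ops :: "('a::complex_hilbert \<Rightarrow>\<^sub>L 'a) set" where
  "bounded_ops = {A :: 'a \<Rightarrow>\<^sub>L 'a. \<forall>c x. A (c *\<^sub>C x) = c *\<^sub>C A x}"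

lift_definition scaleC_op ::
    "complex \<Rightarrow> ('a::complex_hilbert \<Rightarrow>\<^sub>L 'a) \<Rightarrow> ('a \<Rightarrow>\<^sub>L 'a)"  (infixr \<open>*\<^sub>O\<close> 75)
  is "\<lambda>c A x. c *\<^sub>C A x"
  by (rule bounded_linear_compose[OF bounded_linear_scaleC])

definition adj_op :: "('a::complex_hilbert \<Rightarrow>\<^sub>L 'a) \<Rightarrow> ('a \<Rightarrow>\<^sub>L 'a)" where
  "adj_op A = (THE B. B \<in> bounded_ops \<and> (\<forall>x y. cinner (B x) y = cinner x (A y)))"

definition positive_op :: "('a::complex_hilbert \<Rightarrow>\<^sub>L 'a) \<Rightarrow> bool" where
  "positive_op A \<longleftrightarrow> A \<in> bounded_ops \<and> (\<forall>x. cinner x (A x) \<in> \<real>\<^sub>\<ge>\<^sub>0)"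

text \<open>The absolute value $|T| = (T^*T)^{1/2}$, using that the positive square root is unique.\<close>

definition abs_op :: "('a::complex_hilbert \<Rightarrow>\<^sub>L 'a) \<Rightarrow> ('a \<Rightarrow>\<^sub>L 'a)" where
  "abs_op T = (THE P. positive_op P \<and> P o\<^sub>L P = adj_op T o\<^sub>L T)"

text \<open>Orthonormal (Hilbert) bases, i.e. maximal orthonormal sets, of any cardinality.\<close>

definition is_onb :: "'a::complex_hilbert set \<Rightarrow> bool" where
  "is_onb E \<longleftrightarrow>
     (\<forall>e\<in>E. \<forall>f\<in>E. cinner e f = (if e = f then 1 else 0)) \<and>
     (\<forall>x. (\<forall>e\<in>E. cinner e x = 0) \<longrightarrow> x = 0)"

text \<open>
  Neither the summability of the diagonal of the positive operator \<open>abs_op T\<close> nor the trace of a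
  trace-class operator depends on the orthonormal basis.
\<close>

definition trace_class :: "('a::complex_hilbert \<Rightarrow>\<^sub>L 'a) set" where
  "trace_class =
     {T \<in> bounded_ops. \<exists>E. is_onb E \<and> (\<lambda>e. cinner e (abs_op T e)) summable_on E}"

definition op_trace :: "('a::complex_hilbert \<Rightarrow>\<^sub>L 'a) \<Rightarrow> complex" where
  "op_trace T = (\<Sum>\<^sub>\<infinity>e\<in>(SOME E. is_onb E). cinner e (T e))"

definition states :: "('a::complex_hilbert \<Rightarrow>\<^sub>L 'a) set" where
  "states = {\<rho> \<in> trace_class. positive_op \<rho> \<and> op_trace \<rho> = 1}"

text \<open>
  A map on operators is a total function on \<^typ>\<open>'a \<Rightarrow>\<^sub>L 'a\<close>; only its values on
  \<^const>\<open>trace_class\<close> (respectively \<^const>\<open>bounded_ops\<close>, for a dual map) are meaningful.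

  An $n \times n$ matrix of operators acts on the $n$-fold Hilbert sum of the space with itself;
  the following says that this operator is positive.
\<close>

definition positive_op_matrix :: "nat \<Rightarrow> (nat \<Rightarrow> nat \<Rightarrow> ('a::complex_hilbert \<Rightarrow>\<^sub>L 'a)) \<Rightarrow> bool" where
  "positive_op_matrix n T \<longleftrightarrow>
     (\<forall>x :: nat \<Rightarrow> 'a. (\<Sum>i<n. \<Sum>j<n. cinner (x i) (T i j (x j))) \<in> \<real>\<^sub>\<ge>\<^sub>0)"

text \<open>Positivity of all amplifications $\Psi \otimes \mathrm{id}_n$, acting entrywise on matrices.\<close>

definition completely_positive ::
    "(('a::complex_hilbert \<Rightarrow>\<^sub>L 'a) \<Rightarrow> ('a \<Rightarrow>\<^sub>L 'a)) \<Rightarrow> bool" where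
  "completely_positive \<Psi> \<longleftrightarrow>
     (\<forall>n T. (\<forall>i<n. \<forall>j<n. T i j \<in> trace_class) \<and> positive_op_matrix n T
        \<longrightarrow> positive_op_matrix n (\<lambda>i j. \<Psi> (T i j)))"

definition quantum_operation ::
    "(('a::complex_hilbert \<Rightarrow>\<^sub>L 'a) \<Rightarrow> ('a \<Rightarrow>\<^sub>L 'a)) \<Rightarrow> bool" where
  "quantum_operation \<Psi> \<longleftrightarrow>
     (\<forall>T\<in>trace_class. \<Psi> T \<in> trace_class) \<and>
     (\<forall>S\<in>trace_class. \<forall>T\<in>trace_class. \<Psi> (S + T) = \<Psi> S + \<Psi> T) \<and>
     (\<forall>c. \<forall>T\<in>trace_class. \<Psi> (c *\<^sub>O T) = c *\<^sub>O \<Psi> T) \<and>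
     completely_positive \<Psi> \<and>
     (\<forall>T\<in>trace_class. op_trace (\<Psi> T) = op_trace T)"

definition dual_map ::
    "(('a::complex_hilbert \<Rightarrow>\<^sub>L 'a) \<Rightarrow> ('a \<Rightarrow>\<^sub>L 'a)) \<Rightarrow> ('a \<Rightarrow>\<^sub>L 'a) \<Rightarrow> ('a \<Rightarrow>\<^sub>L 'a)" where
  "dual_map \<Psi> S =
     (THE X. X \<in> bounded_ops \<and> (\<forall>T\<in>trace_class. op_trace (\<Psi> T o\<^sub>L S) = op_trace (T o\<^sub>L X)))"

definition left_mult :: "('a::complex_hilbert \<Rightarrow>\<^sub>L 'a) \<Rightarrow> ('a \<Rightarrow>\<^sub>L 'a) \<Rightarrow> ('a \<Rightarrow>\<^sub>L 'a)" where
  "left_mult A T = A o\<^sub>L T"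

definition right_mult :: "('a::complex_hilbert \<Rightarrow>\<^sub>L 'a) \<Rightarrow> ('a \<Rightarrow>\<^sub>L 'a) \<Rightarrow> ('a \<Rightarrow>\<^sub>L 'a)" where
  "right_mult A T = T o\<^sub>L A"

definition commutator :: "('b \<Rightarrow> 'b) \<Rightarrow> ('b \<Rightarrow> 'b) \<Rightarrow> 'b \<Rightarrow> 'b::ab_group_add" where
  "commutator \<Phi> \<Psi> T = \<Phi> (\<Psi> T) - \<Psi> (\<Phi> T)"

definition is_constant_of ::
    "('a::complex_hilbert \<Rightarrow>\<^sub>L 'a) \<Rightarrow> (('a \<Rightarrow>\<^sub>L 'a) \<Rightarrow> ('a \<Rightarrow>\<^sub>L 'a)) \<Rightarrow> bool" where
  "is_constant_of B \<Psi> \<longleftrightarrow>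
     B \<in> bounded_ops \<and>
     (\<forall>\<rho>\<in>states. \<forall>m n. op_trace ((\<Psi> ^^ m) \<rho> o\<^sub>L B) = op_trace ((\<Psi> ^^ n) \<rho> o\<^sub>L B))"

end

theory Submission
  imports Defs
begin

text \<open>
  Write $\Phi = \Psi^\sharp$ for the dual map.  Two of the equivalences are soft.  The trace pairing
  turns right multiplication by \<open>A\<close> on the trace class into left multiplication on the bounded
  operators, so the two commutation relations are transposes of each other
  (\<open>commutator_duality\<close>); and since pure states separate operators, being a constant of the semigroup
  means being fixed by $\Phi$ (\<open>is_constant_of_iff_fixed\<close>).  If $\Phi$ commutes with left
  multiplication by \<open>A\<close>, then evaluating at $1$ and at $A^*$ shows that $A$ and $AA^*$ are fixed,
  because $\Phi$ is unital and commutes with the adjoint.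

  The remaining implication is the multiplicative domain argument.  Complete positivity of $\Psi$
  says that the kernel $k((x,X),(y,Y)) = \langle x, \Phi(X^*Y)\,y\rangle$ is positive semidefinite on
  formal sums of pairs of a vector and an operator (\<open>dual_map_kernel_nonneg\<close>).  If $A$ and $AA^*$ are
  fixed, the formal vector $(y, A^*) - (A^*y, 1)$ has $k$-square
  $\langle y, AA^*y\rangle - \|A^*y\|^2 - \|A^*y\|^2 + \|A^*y\|^2 = 0$; a null vector of a positive
  semidefinite form is orthogonal to everything (\<open>psd_null_vector\<close>), and orthogonality to
  $(z, S^*)$ reads $\langle z, \Phi(SA^*)y\rangle = \langle z, \Phi(S)A^*y\rangle$.  Taking adjoints
  gives $\Phi(AS) = A\,\Phi(S)$.

  Most of the text provides the operator theory on which this rests: adjoints, unique positive square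
  roots, polar decomposition and Parseval's identity; from these, the identification of the trace
  class with the products $B^*C$ of Hilbert-Schmidt operators (\<open>trace_class_factor\<close>,
  \<open>hs_product_trace\<close>), which makes the trace linear, independent of the basis and cyclic
  (\<open>op_trace_cyclic\<close>); and the existence of $\Phi$ (\<open>qo_dual_exists\<close>), where the continuity of $\Psi$
  is extracted from its positivity and trace preservation.
\<close>


section \<open>Geometry of a complex Hilbert space\<close>

lemma cnj_cinner [simp]: "cnj (cinner x y) = cinner y x"
  by (metis cinner_commute)

lemma cinner_add_left: "cinner (x + y) z = cinner x z + cinner y z"
  by (metis cinner_add_right cinner_commute complex_cnj_add)

lemma cinner_scaleC_left: "cinner (a *\<^sub>C x) y = cnj a * cinner x y"
  by (metis cinner_commute cinner_scaleC_right complex_cnj_mult)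

lemma cinner_scaleR_right: "cinner x (r *\<^sub>R y) = of_real r * cinner x y"
  by (metis cinner_scaleC_right scaleC_of_real)

lemma cinner_scaleR_left: "cinner (r *\<^sub>R x) y = of_real r * cinner x y"
  by (metis cinner_scaleC_left scaleC_of_real complex_cnj_complex_of_real)

lemma scaleC_one [simp]: "1 *\<^sub>C x = x"
  using scaleC_of_real[of 1 x] by simp

lemma scaleC_minus_one: "(- 1) *\<^sub>C x = - x"
  using scaleC_of_real[of "-1" x] by simp

lemma scaleC_zero [simp]: "0 *\<^sub>C x = 0"
  using scaleC_of_real[of 0 x] by simp

lemma cinner_minus_right: "cinner x (- y) = - cinner x y"
  using cinner_scaleR_right[of x "-1" y] by simp

lemma cinner_minus_left: "cinner (- x) y = - cinner x y"
  using cinner_scaleR_left[of "-1" x y] by simp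

lemma cinner_diff_right: "cinner x (y - z) = cinner x y - cinner x z"
  using cinner_add_right[of x y "-z"] by (simp add: cinner_minus_right)

lemma cinner_diff_left: "cinner (x - y) z = cinner x z - cinner y z"
  using cinner_add_left[of x "-y" z] by (simp add: cinner_minus_left)

lemmas cinner_simps = cinner_add_left cinner_add_right cinner_diff_left cinner_diff_right
  cinner_minus_left cinner_minus_right cinner_scaleC_left cinner_scaleC_right

lemma norm_sq_eq: "(norm x)\<^sup>2 = Re (cinner x x)"
  by (simp add: cinner_self)

lemma cauchy_schwarz: "cmod (cinner x y) \<le> norm x * norm (y :: 'a::complex_hilbert)"
proof (cases "y = 0")
  case True
  then show ?thesis using cinner_scaleC_right[of x 0 y] by simp
next
  case False
  define z where "z = of_real ((norm y)\<^sup>2) *\<^sub>C x - cinner y x *\<^sub>C y"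
  have "cinner z z = of_real ((norm y)\<^sup>2 * ((norm x)\<^sup>2 * (norm y)\<^sup>2 - (cmod (cinner x y))\<^sup>2))"
  proof -
    have c: "cinner y x * cinner x y = of_real ((cmod (cinner x y))\<^sup>2)"
      using complex_norm_square[of "cinner x y"] by (simp add: mult.commute)
    have "cinner z z = of_real ((norm y)\<^sup>2) * (of_real ((norm y)\<^sup>2) * of_real ((norm x)\<^sup>2)
       - cinner y x * cinner x y)"
      unfolding z_def by (simp only: cinner_simps) (simp add: cinner_self right_diff_distrib mult.left_commute mult.assoc mult.commute del: of_real_power)
    then show ?thesis unfolding c by (simp add: algebra_simps)
  qed
  then have "0 \<le> (norm y)\<^sup>2 * ((norm x)\<^sup>2 * (norm y)\<^sup>2 - (cmod (cinner x y))\<^sup>2)"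
    using cinner_self[of z] by (metis of_real_eq_iff zero_le_power2)
  then have "(cmod (cinner x y))\<^sup>2 \<le> (norm x * norm y)\<^sup>2"
    using False by (simp add: zero_le_mult_iff power_mult_distrib)
  then show ?thesis by (rule power2_le_imp_le) simp
qed

interpretation cinner: bounded_bilinear "cinner :: 'a::complex_hilbert \<Rightarrow> 'a \<Rightarrow> complex"
  by (unfold_locales; (intro exI[of _ 1])?)
     (simp_all add: cinner_add_left cinner_add_right cinner_scaleR_left cinner_scaleR_right
        cauchy_schwarz scaleR_conv_of_real)

declare cinner.zero_left [simp] cinner.zero_right [simp]

lemma norm_add_sq: "(norm (x + y))\<^sup>2 = (norm x)\<^sup>2 + (norm y)\<^sup>2 + 2 * Re (cinner x y)"
proof -
  have "Re (cinner y x) = Re (cinner x y)" by (metis cinner_commute complex_cnj(1) cnj.simps(1))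
  then show ?thesis by (simp add: norm_sq_eq cinner_simps)
qed

lemma norm_diff_sq: "(norm (x - y))\<^sup>2 = (norm x)\<^sup>2 + (norm y)\<^sup>2 - 2 * Re (cinner x y)"
  using norm_add_sq[of x "-y"] by (simp add: cinner_simps)

lemma cinner_eqI: "(\<And>z. cinner z x = cinner z y) \<Longrightarrow> x = y"
  by (metis cinner_diff_right cinner_self eq_iff_diff_eq_0 norm_eq_zero of_real_eq_0_iff zero_eq_power2)

lemma cinner_eqI_left: "(\<And>z. cinner x z = cinner y z) \<Longrightarrow> x = y"
  by (metis cinner_commute cinner_eqI)

lemma linear_term_zero:
  fixes p q :: real
  assumes quad: "\<And>t. 0 \<le> t * p + t\<^sup>2 * q"
  shows "p = 0"
proof (rule ccontr)
  assume p: "p \<noteq> 0"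
  \<comment> \<open>at \<open>t = - p / K\<close> the linear term equals \<open>- K * t\<^sup>2\<close> and dominates because \<open>q < K\<close>\<close>
  define K where "K = \<bar>q\<bar> + 1"
  have K: "K > 0" by (simp add: K_def add_nonneg_pos)
  have "0 \<le> (- p / K) * p + (- p / K)\<^sup>2 * q" by (rule quad)
  also have "\<dots> < (- p / K) * p + (- p / K)\<^sup>2 * K"
    using p K by (intro add_strict_left_mono mult_strict_left_mono) (auto simp: K_def)
  also have "\<dots> = 0" using K by (simp add: power2_eq_square)
  finally show False by simp
qed

definition csubspace :: "'a::complex_hilbert set \<Rightarrow> bool" where
  "csubspace M \<longleftrightarrow> 0 \<in> M \<and> (\<forall>x\<in>M. \<forall>y\<in>M. x + y \<in> M) \<and> (\<forall>c. \<forall>x\<in>M. c *\<^sub>C x \<in> M)"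

lemma csubspace_UNIV: "csubspace UNIV"
  by (simp add: csubspace_def)

lemma orthogonal_closure_zero:
  assumes "u \<in> closure M" "\<And>m. m \<in> M \<Longrightarrow> cinner u m = 0"
  shows "u = 0"
proof -
  have "closed {v. cinner u v = 0}"
    by (intro closed_Collect_eq continuous_intros cinner.continuous_on)
  then have "closure M \<subseteq> {v. cinner u v = 0}"
    using assms(2) by (intro closure_minimal) auto
  then show ?thesis using assms(1) cinner_self[of u] by auto
qed

text \<open>
  The representing vector minimises \<open>norm m ^ 2 - 2 * Re (f m)\<close> over \<open>M\<close>: completing the square,
  this is the squared distance to the representing vector up to a constant, and the parallelogram
  identity makes minimising sequences Cauchy.  The subspace \<open>M\<close> is all of the space for adjoints, a
  closed span for orthogonal projections, and the range of an operator, in general not closed, for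
  the polar decomposition; the representing vector then lies in the closure.
\<close>

lemma riesz_subspace:
  fixes f :: "'a::complex_hilbert \<Rightarrow> complex"
  assumes M: "csubspace M"
    and add: "\<And>x y. x \<in> M \<Longrightarrow> y \<in> M \<Longrightarrow> f (x + y) = f x + f y"
    and scale: "\<And>c x. x \<in> M \<Longrightarrow> f (c *\<^sub>C x) = c * f x"
    and bound: "\<And>x. x \<in> M \<Longrightarrow> cmod (f x) \<le> C * norm x"
  obtains w where "w \<in> closure M" "\<And>m. m \<in> M \<Longrightarrow> cinner w m = f m"
proof -
  define g where "g m = (norm m)\<^sup>2 - 2 * Re (f m)" for m
  have M0: "0 \<in> M" and Madd: "\<And>x y. x \<in> M \<Longrightarrow> y \<in> M \<Longrightarrow> x + y \<in> M"
    and Msc: "\<And>c x. x \<in> M \<Longrightarrow> c *\<^sub>C x \<in> M"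
    using M by (auto simp: csubspace_def)
  have MscR: "r *\<^sub>R x \<in> M" if "x \<in> M" for r x
    using Msc[OF that, of "of_real r"] by (simp add: scaleC_of_real)
  have fR: "f (r *\<^sub>R x) = of_real r * f x" if "x \<in> M" for r x
    using scale[OF that, of "of_real r"] by (simp add: scaleC_of_real)
  have lower: "- C\<^sup>2 \<le> g m" if "m \<in> M" for m
  proof -
    have "Re (f m) \<le> C * norm m"
      using bound[OF that] complex_Re_le_cmod[of "f m"] by linarith
    moreover have "0 \<le> (norm m - C)\<^sup>2" by simp
    ultimately show ?thesis unfolding g_def by (simp add: power2_diff mult_ac)
  qed
  define d where "d = Inf (g ` M)"
  have bdd: "bdd_below (g ` M)" using lower by (intro bdd_belowI2) auto
  have dle: "d \<le> g m" if "m \<in> M" for m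
    unfolding d_def using that bdd by (intro cInf_lower) auto
  have "\<exists>m\<in>M. g m < d + 1 / real (Suc n)" for n
  proof -
    have "Inf (g ` M) < d + 1 / real (Suc n)" unfolding d_def by simp
    then show ?thesis using M0 bdd by (subst (asm) cInf_less_iff) auto
  qed
  then obtain s where sM: "\<And>n. s n \<in> M" and sg: "\<And>n. g (s n) < d + 1 / real (Suc n)"
    by metis
  have par: "(norm (s n - s k))\<^sup>2 \<le> 2 / real (Suc n) + 2 / real (Suc k)" for n k
  proof -
    have mid: "(1/2) *\<^sub>R (s n + s k) \<in> M" using sM Madd MscR by blast
    have gm: "g ((1/2) *\<^sub>R (s n + s k)) = (norm (s n + s k))\<^sup>2 / 4 - Re (f (s n)) - Re (f (s k))"
    proof -
      have "f ((1/2) *\<^sub>R (s n + s k)) = (f (s n) + f (s k)) / 2"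
        using sM Madd by (simp only: fR add) simp
      moreover have "(norm ((1/2) *\<^sub>R (s n + s k)))\<^sup>2 = (norm (s n + s k))\<^sup>2 / 4"
        by (simp only: norm_scaleR power_mult_distrib) (simp add: power_divide)
      ultimately show ?thesis by (simp add: g_def add_divide_distrib)
    qed
    have "(norm (s n - s k))\<^sup>2 = 2 * g (s n) + 2 * g (s k) - 4 * g ((1/2) *\<^sub>R (s n + s k))"
      unfolding gm unfolding g_def norm_add_sq norm_diff_sq by (simp add: field_simps)
    then show ?thesis using dle[OF mid] sg[of n] sg[of k] by simp
  qed
  have "Cauchy s"
  proof (rule metric_CauchyI)
    fix e :: real assume e: "e > 0"
    obtain N where N: "4 / e\<^sup>2 < real N" using reals_Archimedean2 by blast
    show "\<exists>N. \<forall>m\<ge>N. \<forall>n\<ge>N. dist (s m) (s n) < e"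
    proof (intro exI[of _ N] allI impI)
      fix m n assume mn: "m \<ge> N" "n \<ge> N"
      have b: "2 / real (Suc k) < e\<^sup>2 / 2" if "k \<ge> N" for k
      proof -
        have "4 / e\<^sup>2 < real (Suc k)" using N that by linarith
        then show ?thesis using e by (simp add: field_simps)
      qed
      have "(norm (s m - s n))\<^sup>2 < e\<^sup>2" using par[of m n] b[OF mn(1)] b[OF mn(2)] by linarith
      then show "dist (s m) (s n) < e" using e by (simp add: dist_norm power_less_imp_less_base)
    qed
  qed
  then obtain w where w: "s \<longlonglongrightarrow> w" using Cauchy_convergent convergent_def by blast
  have wM: "w \<in> closure M" using w sM closure_sequential by blast
  have re: "Re (cinner w m) = Re (f m)" if m: "m \<in> M" for m
  proof -
    define p where "p = Re (cinner w m) - Re (f m)"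
    have quad: "0 \<le> 2 * t * p + t\<^sup>2 * (norm m)\<^sup>2" for t
    proof -
      have "- 1 / real (Suc n) \<le> 2 * t * (Re (cinner (s n) m) - Re (f m)) + t\<^sup>2 * (norm m)\<^sup>2" for n
      proof -
        have "g (s n + t *\<^sub>R m) - g (s n)
            = 2 * t * (Re (cinner (s n) m) - Re (f m)) + t\<^sup>2 * (norm m)\<^sup>2"
          unfolding g_def norm_add_sq using sM m MscR
          by (simp add: add fR cinner_scaleR_right power_mult_distrib algebra_simps)
        moreover have "d \<le> g (s n + t *\<^sub>R m)" using sM m MscR Madd dle by blast
        ultimately show ?thesis using sg[of n] by simp
      qed
      moreover have "(\<lambda>n. - 1 / real (Suc n)) \<longlonglongrightarrow> 0"
        using LIMSEQ_inverse_real_of_nat_add_minus[of 0] by (simp add: inverse_eq_divide)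
      moreover have "(\<lambda>n. 2 * t * (Re (cinner (s n) m) - Re (f m)) + t\<^sup>2 * (norm m)\<^sup>2)
          \<longlonglongrightarrow> 2 * t * p + t\<^sup>2 * (norm m)\<^sup>2"
        unfolding p_def by (intro tendsto_intros cinner.tendsto w)
      ultimately show ?thesis by (intro LIMSEQ_le) auto
    qed
    have "2 * p = 0"
      by (rule linear_term_zero[of _ "(norm m)\<^sup>2"]) (use quad in \<open>simp add: mult_ac\<close>)
    then show ?thesis by (simp add: p_def)
  qed
  have "cinner w m = f m" if m: "m \<in> M" for m
  proof (rule complex_eqI)
    show "Re (cinner w m) = Re (f m)" using re[OF m] .
    show "Im (cinner w m) = Im (f m)"
      using re[OF Msc[OF m], of \<i>] scale[OF m, of \<i>] by (simp add: cinner_scaleC_right)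
  qed
  then show ?thesis using that wM by blast
qed

section \<open>Bounded operators and adjoints\<close>

lemma bounded_ops_scaleC: "A \<in> bounded_ops \<Longrightarrow> A (c *\<^sub>C x) = c *\<^sub>C A x"
  by (simp add: bounded_ops_def)

lemma bounded_ops_add [intro]: "A \<in> bounded_ops \<Longrightarrow> B \<in> bounded_ops \<Longrightarrow> A + B \<in> bounded_ops"
  by (simp add: bounded_ops_def blinfun.add_left scaleC_add_right)

lemma scaleC_diff_right: "c *\<^sub>C (x - y) = c *\<^sub>C x - c *\<^sub>C y"
  using bounded_linear_scaleC[of c] by (metis bounded_linear.linear linear_diff)

lemma bounded_ops_diff [intro]: "A \<in> bounded_ops \<Longrightarrow> B \<in> bounded_ops \<Longrightarrow> A - B \<in> bounded_ops"
  by (simp add: bounded_ops_def blinfun.diff_left scaleC_diff_right)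

lemma bounded_ops_compose [intro]:
  "A \<in> bounded_ops \<Longrightarrow> B \<in> bounded_ops \<Longrightarrow> A o\<^sub>L B \<in> bounded_ops"
  by (simp add: bounded_ops_def)

lemma bounded_ops_scaleC_op [intro]: "A \<in> bounded_ops \<Longrightarrow> c *\<^sub>O A \<in> bounded_ops"
  by (simp add: bounded_ops_def scaleC_op.rep_eq scaleC_scaleC mult.commute)

lemma bounded_ops_scaleR [intro]: "A \<in> bounded_ops \<Longrightarrow> r *\<^sub>R A \<in> bounded_ops"
  by (simp add: bounded_ops_def scaleR_blinfun.rep_eq scaleC_scaleC mult.commute
      flip: scaleC_of_real)

lemma bounded_ops_id [intro]: "id_blinfun \<in> bounded_ops"
  by (simp add: bounded_ops_def)

lemma bounded_ops_zero [intro]: "0 \<in> bounded_ops"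
  by (simp add: bounded_ops_def) (metis scaleC_zero scaleC_scaleC mult_zero_right)

lemma bounded_ops_eqI:
  "(\<And>x y. cinner x (blinfun_apply A y) = cinner x (blinfun_apply B y)) \<Longrightarrow> A = B"
  by (intro blinfun_eqI cinner_eqI)

text \<open>
  Applying the Riesz lemma in the linear slot of a bounded sesquilinear form that is defined
  only for second arguments in \<open>M\<close>.
\<close>

lemma sesquilinear_operator:
  fixes b :: "'a::complex_hilbert \<Rightarrow> 'a \<Rightarrow> complex"
  assumes M: "csubspace M" and C: "C \<ge> 0"
    and add_left: "\<And>x y m. m \<in> M \<Longrightarrow> b (x + y) m = b x m + b y m"
    and scale_left: "\<And>c y m. m \<in> M \<Longrightarrow> b (c *\<^sub>C y) m = cnj c * b y m"
    and add_right: "\<And>y m n. m \<in> M \<Longrightarrow> n \<in> M \<Longrightarrow> b y (m + n) = b y m + b y n"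
    and scale_right: "\<And>c y m. m \<in> M \<Longrightarrow> b y (c *\<^sub>C m) = c * b y m"
    and bound: "\<And>y m. m \<in> M \<Longrightarrow> cmod (b y m) \<le> C * norm y * norm m"
  obtains W where "W \<in> bounded_ops" "\<And>y. blinfun_apply W y \<in> closure M"
    "\<And>y m. m \<in> M \<Longrightarrow> cinner (blinfun_apply W y) m = b y m"
proof -
  have "\<exists>w \<in> closure M. \<forall>m\<in>M. cinner w m = b y m" for y
    using riesz_subspace[OF M, of "b y" "C * norm y"] add_right scale_right bound by metis
  then obtain F where Fcl: "\<And>y. F y \<in> closure M" and F: "\<And>y m. m \<in> M \<Longrightarrow> cinner (F y) m = b y m"
    by metis
  have Madd: "\<And>x y. x \<in> M \<Longrightarrow> y \<in> M \<Longrightarrow> x + y \<in> M"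
    and Msc: "\<And>c x. x \<in> M \<Longrightarrow> c *\<^sub>C x \<in> M"
    using M by (auto simp: csubspace_def)
  have cladd: "u + v \<in> closure M" if uv: "u \<in> closure M" "v \<in> closure M" for u v
  proof -
    obtain s t where s: "\<And>n::nat. s n \<in> M" "s \<longlonglongrightarrow> u" and t: "\<And>n::nat. t n \<in> M" "t \<longlonglongrightarrow> v"
      using uv by (auto simp: closure_sequential)
    have "(\<lambda>n. s n + t n) \<longlonglongrightarrow> u + v" using s t by (intro tendsto_add)
    then show ?thesis unfolding closure_sequential
      using s t Madd by (intro exI[of _ "\<lambda>n. s n + t n"]) auto
  qed
  have clsc: "c *\<^sub>C u \<in> closure M" if u: "u \<in> closure M" for u c
  proof -
    obtain s where s: "\<And>n::nat. s n \<in> M" "s \<longlonglongrightarrow> u"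
      using u by (auto simp: closure_sequential)
    have "(\<lambda>n. c *\<^sub>C s n) \<longlonglongrightarrow> c *\<^sub>C u"
      by (rule bounded_linear.tendsto[OF bounded_linear_scaleC s(2)])
    then show ?thesis unfolding closure_sequential
      using s Msc by (intro exI[of _ "\<lambda>n. c *\<^sub>C s n"]) auto
  qed
  have eqI: "u = v" if "u \<in> closure M" "v \<in> closure M" "\<And>m. m \<in> M \<Longrightarrow> cinner u m = cinner v m" for u v
  proof -
    have "u + (-1) *\<^sub>C v = 0"
      by (rule orthogonal_closure_zero[of _ M])
         (use that cladd clsc in \<open>auto simp: cinner_simps\<close>)
    then show ?thesis by (simp add: scaleC_minus_one)
  qed
  have Fadd: "F (x + y) = F x + F y" for x y
    by (rule eqI) (auto simp: Fcl cladd F cinner_add_left add_left)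
  have Fsc: "F (c *\<^sub>C x) = c *\<^sub>C F x" for c x
    by (rule eqI) (auto simp: Fcl clsc F cinner_scaleC_left scale_left)
  have Fbd: "norm (F y) \<le> norm y * C" for y
  proof -
    have "closed {v. cmod (cinner (F y) v) \<le> C * norm y * norm v}"
      by (intro closed_Collect_le continuous_intros cinner.continuous_on)
    then have "closure M \<subseteq> {v. cmod (cinner (F y) v) \<le> C * norm y * norm v}"
      using bound by (intro closure_minimal) (auto simp: F)
    then have "cmod (cinner (F y) (F y)) \<le> C * norm y * norm (F y)" using Fcl by blast
    then have "norm (F y) * norm (F y) \<le> (C * norm y) * norm (F y)"
      by (simp add: cinner_self power2_eq_square norm_mult)
    then show ?thesis using C
      by (cases "norm (F y) = 0") (auto simp: mult.commute)
  qed
  have bl: "bounded_linear F"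
  proof (rule bounded_linear_intro[where K = C])
    show "F (r *\<^sub>R x) = r *\<^sub>R F x" for r x
      using Fsc[of "of_real r" x] by (simp only: scaleC_of_real)
  qed (rule Fadd Fbd)+
  note ap = bounded_linear_Blinfun_apply[OF bl]
  show ?thesis
  proof (rule that[of "Blinfun F"])
    show "Blinfun F \<in> bounded_ops" by (simp add: bounded_ops_def ap Fsc)
  qed (unfold ap, rule Fcl, erule F)
qed

lemma adj_op_ex1:
  assumes "A \<in> bounded_ops"
  shows "\<exists>!B. B \<in> bounded_ops \<and> (\<forall>x y. cinner (blinfun_apply B x) y = cinner x (blinfun_apply A y))"
proof -
  have "cmod (cinner y (A m)) \<le> norm A * norm y * norm m" for y m
  proof -
    have "norm y * norm (A m) \<le> norm y * (norm A * norm m)"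
      by (intro mult_left_mono norm_blinfun) auto
    then show ?thesis using cauchy_schwarz[of y "A m"] by (simp add: mult_ac)
  qed
  note bound = this
  obtain W where W: "W \<in> bounded_ops" "\<And>y m. cinner (blinfun_apply W y) m = cinner y (A m)"
    by (rule sesquilinear_operator[OF csubspace_UNIV, of "norm A" "\<lambda>y m. cinner y (A m)"])
       (simp_all add: cinner_simps blinfun.add_right bounded_ops_scaleC[OF assms] bound)
  show ?thesis
  proof (rule ex1I[of _ W])
    fix B assume B: "B \<in> bounded_ops \<and> (\<forall>x y. cinner (blinfun_apply B x) y = cinner x (blinfun_apply A y))"
    show "B = W" by (intro blinfun_eqI cinner_eqI_left) (simp add: B W)
  qed (simp add: W)
qed

lemma adj_op_in [intro]: "A \<in> bounded_ops \<Longrightarrow> adj_op A \<in> bounded_ops"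
  using theI'[OF adj_op_ex1, of A] unfolding adj_op_def by blast

lemma cinner_adj_left: "A \<in> bounded_ops \<Longrightarrow> cinner (adj_op A x) y = cinner x (A y)"
  using theI'[OF adj_op_ex1, of A] unfolding adj_op_def by blast

lemma cinner_adj_right: "A \<in> bounded_ops \<Longrightarrow> cinner x (adj_op A y) = cinner (A x) y"
  by (metis cinner_adj_left cinner_commute)

lemma adj_opI:
  assumes "A \<in> bounded_ops" "B \<in> bounded_ops" "\<And>x y. cinner (blinfun_apply B x) y = cinner x (A y)"
  shows "adj_op A = B"
  using adj_op_ex1[OF assms(1)] assms adj_op_in[OF assms(1)] cinner_adj_left[OF assms(1)] by blast

lemma adj_adj [simp]: "A \<in> bounded_ops \<Longrightarrow> adj_op (adj_op A) = A"
  by (intro adj_opI) (auto simp: cinner_adj_right)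

lemma adj_compose:
  "A \<in> bounded_ops \<Longrightarrow> B \<in> bounded_ops \<Longrightarrow> adj_op (A o\<^sub>L B) = adj_op B o\<^sub>L adj_op A"
  by (intro adj_opI) (auto simp: cinner_adj_left)

lemma adj_add: "A \<in> bounded_ops \<Longrightarrow> B \<in> bounded_ops \<Longrightarrow> adj_op (A + B) = adj_op A + adj_op B"
  by (intro adj_opI) (auto simp: cinner_adj_left cinner_simps blinfun.add_left)

lemma adj_scaleC_op: "A \<in> bounded_ops \<Longrightarrow> adj_op (c *\<^sub>O A) = cnj c *\<^sub>O adj_op A"
  by (intro adj_opI) (auto simp: cinner_adj_left cinner_simps scaleC_op.rep_eq)

lemma adj_id [simp]: "adj_op id_blinfun = id_blinfun"
  by (intro adj_opI) auto


section \<open>Positive operators and their square roots\<close>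

lemma positive_op_in: "positive_op P \<Longrightarrow> P \<in> bounded_ops"
  by (simp add: positive_op_def)

lemma positive_op_Re: "positive_op P \<Longrightarrow> 0 \<le> Re (cinner x (blinfun_apply P x))"
  by (simp add: positive_op_def complex_nonneg_Reals_iff)

lemma positive_op_Im: "positive_op P \<Longrightarrow> Im (cinner x (blinfun_apply P x)) = 0"
  by (simp add: positive_op_def complex_nonneg_Reals_iff)

lemma positive_op_selfadjoint:
  assumes "positive_op P"
  shows "cinner (blinfun_apply P x) y = cinner x (blinfun_apply P y)"
proof -
  note P = positive_op_in[OF assms]
  have a: "Im (cinner x (P y)) + Im (cinner y (P x)) = 0"
    using positive_op_Im[OF assms, of "x + y"] positive_op_Im[OF assms, of x]
      positive_op_Im[OF assms, of y]
    by (simp add: cinner_simps blinfun.add_right)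
  have b: "Re (cinner x (P y)) - Re (cinner y (P x)) = 0"
    using positive_op_Im[OF assms, of "x + \<i> *\<^sub>C y"] positive_op_Im[OF assms, of x]
      positive_op_Im[OF assms, of y]
    by (simp add: cinner_simps blinfun.add_right bounded_ops_scaleC[OF P])
  have "cinner x (P y) = cnj (cinner y (P x))"
    using a b by (intro complex_eqI) (simp_all del: cnj_cinner)
  then show ?thesis by simp
qed

lemma positive_op_adj: "positive_op P \<Longrightarrow> adj_op P = P"
  by (intro adj_opI) (auto simp: positive_op_in positive_op_selfadjoint)

lemma positive_op_scaleR: "positive_op P \<Longrightarrow> 0 \<le> r \<Longrightarrow> positive_op (r *\<^sub>R P)"
  by (auto simp: positive_op_def complex_nonneg_Reals_iff cinner_scaleR_right scaleR_blinfun.rep_eq)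

lemma positive_op_adj_compose:
  assumes "T \<in> bounded_ops"
  shows "positive_op (adj_op T o\<^sub>L T)"
  using assms
  by (auto simp: positive_op_def cinner_adj_right cinner_self complex_nonneg_Reals_iff)

text \<open>Evaluating the quadratic form of \<open>P\<close> at \<open>norm P *\<^sub>R x - P x\<close>.\<close>

lemma positive_op_norm_sq_le:
  assumes "positive_op P"
  shows "(norm (blinfun_apply P x))\<^sup>2 \<le> norm P * Re (cinner x (P x))"
proof (cases "P = 0")
  case False
  define N where "N = norm P"
  have N: "N > 0" using False by (simp add: N_def)
  define u where "u = N *\<^sub>R x - P x"
  have "Re (cinner (P x) (P (P x))) \<le> N * (norm (P x))\<^sup>2"
  proof -
    have "Re (cinner (P x) (P (P x))) \<le> norm (P x) * norm (P (P x))"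
      using cauchy_schwarz complex_Re_le_cmod order_trans by blast
    also have "\<dots> \<le> norm (P x) * (N * norm (P x))"
      unfolding N_def by (intro mult_left_mono norm_blinfun) auto
    finally show ?thesis by (simp add: power2_eq_square mult_ac)
  qed
  moreover have "cinner x (P (P x)) = of_real ((norm (P x))\<^sup>2)"
    using positive_op_selfadjoint[OF assms, of x "P x"] by (simp add: cinner_self)
  ultimately have "Re (cinner u (P u)) \<le> N\<^sup>2 * Re (cinner x (P x)) - N * (norm (P x))\<^sup>2"
    unfolding u_def
    by (simp add: cinner_simps cinner_scaleR_left cinner_scaleR_right blinfun.diff_right
        blinfun.scaleR_right cinner_self power2_eq_square algebra_simps)
  then have "0 \<le> N * (N * Re (cinner x (P x)) - (norm (P x))\<^sup>2)"
    using positive_op_Re[OF assms, of u] by (simp add: power2_eq_square algebra_simps)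
  then show ?thesis using N by (simp add: zero_le_mult_iff N_def)
qed simp

lemma positive_op_null: "positive_op P \<Longrightarrow> Re (cinner x (blinfun_apply P x)) = 0 \<Longrightarrow> P x = 0"
  using positive_op_norm_sq_le[of P x] by simp

text \<open>
  With \<open>X = 1 - P\<close> and \<open>norm P \<le> 1\<close>, the equation \<open>D o D = P\<close> for \<open>D = 1 - Y\<close> reads
  \<open>Y = (X + Y o Y) / 2\<close>.  The increments of the resulting iteration are dominated by those of the
  scalar iteration for \<open>X = 1\<close>, which increases to a limit at most \<open>1\<close>.
\<close>

lemma positive_sqrt_contraction:
  fixes P :: "'a::complex_hilbert \<Rightarrow>\<^sub>L 'a"
  assumes P: "positive_op P" and n1: "norm P \<le> 1"
  obtains D where "positive_op D" "D o\<^sub>L D = P" "\<And>C. C o\<^sub>L P = P o\<^sub>L C \<Longrightarrow> C o\<^sub>L D = D o\<^sub>L C"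
proof -
  define I :: "'a \<Rightarrow>\<^sub>L 'a" where "I = id_blinfun"
  define X where "X = I - P"
  note comp_simps = blinfun.add_left blinfun.diff_left blinfun.scaleR_left blinfun.add_right
    blinfun.diff_right blinfun.scaleR_right
  have Iap: "blinfun_apply I x = x" for x by (simp add: I_def)
  have X: "X \<in> bounded_ops" unfolding X_def I_def using P by (auto simp: positive_op_in)
  have X1: "norm X \<le> 1"
  proof (rule norm_blinfun_bound)
    fix x
    have "(norm (P x))\<^sup>2 \<le> 1 * Re (cinner x (P x))"
      using positive_op_norm_sq_le[OF P, of x] n1 positive_op_Re[OF P, of x]
      by (meson mult_right_mono order_trans)
    then have "(norm (x - P x))\<^sup>2 \<le> (norm x)\<^sup>2"
      using positive_op_Re[OF P, of x] by (simp add: norm_diff_sq)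
    then show "norm (X x) \<le> 1 * norm x"
      by (simp add: X_def Iap blinfun.diff_left)
  qed simp
  define Y where "Y = rec_nat 0 (\<lambda>_ Z. (1/2) *\<^sub>R (X + (Z o\<^sub>L Z)))"
  define y :: "nat \<Rightarrow> real" where "y = rec_nat 0 (\<lambda>_ z. (1 + z\<^sup>2) / 2)"
  have Y0: "Y 0 = 0" and YS: "\<And>n. Y (Suc n) = (1/2) *\<^sub>R (X + (Y n o\<^sub>L Y n))" by (simp_all add: Y_def)
  have y0: "y 0 = 0" and yS: "\<And>n. y (Suc n) = (1 + (y n)\<^sup>2) / 2" by (simp_all add: y_def)
  have yb: "0 \<le> y n \<and> y n \<le> 1" for n
    by (induction n) (auto simp: y0 yS power_le_one)
  have yinc: "y n \<le> y (Suc n)" for n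
  proof -
    have "0 \<le> (1 - y n)\<^sup>2" by simp
    then show ?thesis by (simp add: yS power2_diff)
  qed
  have Yn: "norm (Y n) \<le> y n" for n
  proof (induction n)
    case (Suc n)
    have "norm (Y n o\<^sub>L Y n) \<le> y n * y n"
      using norm_blinfun_compose[of "Y n" "Y n"] mult_mono[OF Suc Suc] yb[of n] by fastforce
    then have "norm (X + (Y n o\<^sub>L Y n)) \<le> 1 + (y n)\<^sup>2"
      using norm_triangle_ineq[of X "Y n o\<^sub>L Y n"] X1 by (simp add: power2_eq_square)
    then show ?case by (simp add: YS yS)
  qed (simp add: Y0 y0)
  have Yd: "norm (Y (Suc n) - Y n) \<le> y (Suc n) - y n" for n
  proof (induction n)
    case 0
    then show ?case using X1 by (simp add: YS yS Y0 y0)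
  next
    case (Suc n)
    define a where "a = Y (Suc n)"
    define b where "b = Y n"
    \<comment> \<open>the difference of squares, factored in an order that avoids commuting \<open>a\<close> with \<open>b\<close>\<close>
    have eq: "Y (Suc (Suc n)) - Y (Suc n) = (1/2) *\<^sub>R ((a o\<^sub>L (a - b)) + ((a - b) o\<^sub>L b))"
      unfolding YS[of "Suc n"] YS[of n] a_def[symmetric] b_def[symmetric]
      by (intro blinfun_eqI) (simp add: comp_simps algebra_simps YS a_def b_def)
    have d: "norm (a - b) \<le> y (Suc n) - y n" using Suc by (simp add: a_def b_def)
    have "norm (a o\<^sub>L (a - b)) \<le> y (Suc n) * (y (Suc n) - y n)"
      by (rule order_trans[OF norm_blinfun_compose mult_mono])
         (use d Yn[of "Suc n"] yb in \<open>auto simp: a_def\<close>)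
    moreover have "norm ((a - b) o\<^sub>L b) \<le> (y (Suc n) - y n) * y n"
      by (rule order_trans[OF norm_blinfun_compose mult_mono])
         (use d Yn[of n] yb yinc in \<open>auto simp: b_def\<close>)
    ultimately have "norm ((a o\<^sub>L (a - b)) + ((a - b) o\<^sub>L b)) \<le> (y (Suc n))\<^sup>2 - (y n)\<^sup>2"
      using norm_triangle_ineq[of "a o\<^sub>L (a - b)" "(a - b) o\<^sub>L b"]
      by (simp add: power2_eq_square algebra_simps)
    then show ?case unfolding eq by (simp add: yS[of "Suc n"] yS[of n] diff_divide_distrib[symmetric])
  qed
  have tele: "norm (Y (n + k) - Y n) \<le> y (n + k) - y n" for n k
  proof (induction k)
    case (Suc k)
    have "Y (n + Suc k) - Y n = (Y (Suc (n + k)) - Y (n + k)) + (Y (n + k) - Y n)" by simp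
    then have "norm (Y (n + Suc k) - Y n) \<le> norm (Y (Suc (n + k)) - Y (n + k)) + norm (Y (n + k) - Y n)"
      by (metis norm_triangle_ineq)
    then show ?case using Suc Yd[of "n + k"] by simp
  qed simp
  have "incseq y" using yinc by (rule incseq_SucI)
  then have "convergent y"
    using yb by (intro Bseq_mono_convergent) (auto intro!: BseqI'[where K = 1] simp: incseq_def)
  then have cy: "Cauchy y" by (rule convergent_Cauchy)
  have "Cauchy Y"
  proof (rule metric_CauchyI)
    fix e :: real assume "e > 0"
    then obtain N where N: "\<And>m n. m \<ge> N \<Longrightarrow> n \<ge> N \<Longrightarrow> dist (y m) (y n) < e"
      using cy by (meson metric_CauchyD)
    have main: "dist (Y m) (Y n) < e" if "n \<ge> N" "m \<ge> n" for m n
      using tele[of n "m - n"] N[of m n] that by (simp add: dist_norm)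
    show "\<exists>N. \<forall>m\<ge>N. \<forall>n\<ge>N. dist (Y m) (Y n) < e"
      using main by (metis dist_commute nle_le)
  qed
  then obtain Z where Z: "Y \<longlonglongrightarrow> Z" using Cauchy_convergent convergent_def by blast
  have comp_lim: "(\<lambda>n. F n o\<^sub>L G n) \<longlonglongrightarrow> (f o\<^sub>L g)" if "F \<longlonglongrightarrow> f" "G \<longlonglongrightarrow> g"
    for F G :: "nat \<Rightarrow> 'a \<Rightarrow>\<^sub>L 'a" and f g
    using bounded_bilinear.tendsto[OF bounded_bilinear_blinfun_compose] that by blast
  have Zap: "(\<lambda>n. Y n x) \<longlonglongrightarrow> Z x" for x
    by (intro blinfun.tendsto Z tendsto_const)
  have "(\<lambda>n. Y (Suc n)) \<longlonglongrightarrow> (1/2) *\<^sub>R (X + (Z o\<^sub>L Z))"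
    unfolding YS by (intro tendsto_intros comp_lim Z)
  moreover have "(\<lambda>n. Y (Suc n)) \<longlonglongrightarrow> Z" using Z by (rule LIMSEQ_Suc)
  ultimately have fixZ: "Z = (1/2) *\<^sub>R (X + (Z o\<^sub>L Z))" using LIMSEQ_unique by blast
  have Yop: "Y n \<in> bounded_ops" for n
    by (induction n) (auto simp: Y0 YS intro: X)
  have Zop: "Z \<in> bounded_ops"
    unfolding bounded_ops_def
  proof (intro CollectI allI)
    fix c x
    have "(\<lambda>n. c *\<^sub>C Y n x) \<longlonglongrightarrow> c *\<^sub>C Z x"
      by (rule bounded_linear.tendsto[OF bounded_linear_scaleC Zap])
    moreover have "(\<lambda>n. c *\<^sub>C Y n x) \<longlonglongrightarrow> Z (c *\<^sub>C x)"
      using Zap[of "c *\<^sub>C x"] by (simp add: bounded_ops_scaleC[OF Yop])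
    ultimately show "Z (c *\<^sub>C x) = c *\<^sub>C Z x" by (rule LIMSEQ_unique[symmetric])
  qed
  have Xsa: "cinner (X x) z = cinner x (X z)" for x z
    by (simp add: X_def Iap blinfun.diff_left cinner_simps positive_op_selfadjoint[OF P])
  have Ysa: "cinner (Y n x) z = cinner x (Y n z)" for n x z
  proof (induction n arbitrary: x z)
    case (Suc n)
    then show ?case
      by (simp add: YS comp_simps cinner_simps cinner_scaleR_left cinner_scaleR_right Xsa)
  qed (simp add: Y0)
  have Zsa: "cinner (Z x) z = cinner x (Z z)" for x z
  proof -
    have "(\<lambda>n. cinner (Y n x) z) \<longlonglongrightarrow> cinner (Z x) z" by (intro cinner.tendsto Zap tendsto_const)
    moreover have "(\<lambda>n. cinner (Y n x) z) \<longlonglongrightarrow> cinner x (Z z)"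
      unfolding Ysa by (intro cinner.tendsto Zap tendsto_const)
    ultimately show ?thesis by (rule LIMSEQ_unique)
  qed
  have Z1: "norm Z \<le> 1"
    using Yn yb by (intro LIMSEQ_le_const2[OF tendsto_norm[OF Z]]) (meson order_trans)
  define D where "D = I - Z"
  have "positive_op D"
    unfolding positive_op_def complex_nonneg_Reals_iff
  proof (intro conjI allI)
    show "D \<in> bounded_ops" unfolding D_def I_def using Zop by auto
    fix x
    have "cmod (cinner x (Z x)) \<le> norm x * (1 * norm x)"
      by (rule order_trans[OF cauchy_schwarz]) 
         (meson Z1 mult_left_mono mult_right_mono norm_blinfun norm_ge_zero order_trans)
    then have "Re (cinner x (Z x)) \<le> (norm x)\<^sup>2"
      using complex_Re_le_cmod[of "cinner x (Z x)"] by (simp add: power2_eq_square)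
    then show "0 \<le> Re (cinner x (D x))"
      by (simp add: D_def Iap blinfun.diff_left cinner_simps cinner_self)
    have "cnj (cinner x (Z x)) = cinner x (Z x)" using Zsa[of x x] by simp
    then have "Im (cinner x (Z x)) = 0" by (metis Reals_cnj_iff complex_is_Real_iff)
    then show "Im (cinner x (D x)) = 0"
      by (simp add: D_def Iap blinfun.diff_left cinner_simps cinner_self)
  qed
  moreover have "D o\<^sub>L D = P"
  proof (rule blinfun_eqI)
    fix x
    have "2 *\<^sub>R Z x = X x + Z (Z x)"
      using arg_cong[OF fixZ, of "\<lambda>W. 2 *\<^sub>R blinfun_apply W x"]
      by (simp add: blinfun.add_left blinfun.scaleR_left)
    then show "(D o\<^sub>L D) x = P x"
      by (simp add: D_def X_def Iap comp_simps scaleR_2 algebra_simps)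
  qed
  moreover have "C o\<^sub>L D = D o\<^sub>L C" if C: "C o\<^sub>L P = P o\<^sub>L C" for C
  proof -
    have Cp: "C (P x) = P (C x)" for x using C by (metis blinfun_compose.rep_eq comp_apply)
    have Cy: "C (Y n x) = Y n (C x)" for n x
      by (induction n arbitrary: x) (simp_all add: Y0 YS comp_simps X_def Iap Cp)
    have "C (Z x) = Z (C x)" for x
    proof -
      have "(\<lambda>n. C (Y n x)) \<longlonglongrightarrow> C (Z x)" by (intro blinfun.tendsto Zap tendsto_const)
      then show ?thesis unfolding Cy using Zap LIMSEQ_unique by blast
    qed
    then show ?thesis by (intro blinfun_eqI) (simp add: D_def comp_simps Iap)
  qed
  ultimately show ?thesis using that by blast
qed

lemma positive_sqrt:
  assumes P: "positive_op P"
  obtains D where "positive_op D" "D o\<^sub>L D = P" "\<And>C. C o\<^sub>L P = P o\<^sub>L C \<Longrightarrow> C o\<^sub>L D = D o\<^sub>L C"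
proof -
  define r where "r = norm P + 1"
  have r: "r > 0" by (simp add: r_def add_nonneg_pos)
  have "positive_op (inverse r *\<^sub>R P)" using P r by (intro positive_op_scaleR) auto
  moreover have "norm (inverse r *\<^sub>R P) \<le> 1" using r by (simp add: r_def field_simps)
  ultimately obtain D where D: "positive_op D" "D o\<^sub>L D = inverse r *\<^sub>R P"
    "\<And>C. C o\<^sub>L (inverse r *\<^sub>R P) = (inverse r *\<^sub>R P) o\<^sub>L C \<Longrightarrow> C o\<^sub>L D = D o\<^sub>L C"
    by (rule positive_sqrt_contraction) blast
  have scl: "(s *\<^sub>R F) o\<^sub>L G = s *\<^sub>R (F o\<^sub>L G)" and scr: "F o\<^sub>L (s *\<^sub>R G) = s *\<^sub>R (F o\<^sub>L G)"
    for s and F G :: "'a \<Rightarrow>\<^sub>L 'a"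
    by (rule blinfun_eqI, simp add: blinfun.scaleR_left blinfun.scaleR_right)+
  show ?thesis
  proof (rule that[of "sqrt r *\<^sub>R D"])
    show "positive_op (sqrt r *\<^sub>R D)" using D(1) r by (intro positive_op_scaleR) auto
    have "sqrt r * (sqrt r * inverse r) = 1" using r by (simp flip: mult.assoc)
    then show "(sqrt r *\<^sub>R D) o\<^sub>L (sqrt r *\<^sub>R D) = P" by (simp add: scl scr D(2))
    fix C assume "C o\<^sub>L P = P o\<^sub>L C"
    then have "C o\<^sub>L D = D o\<^sub>L C" by (intro D(3)) (simp add: scl scr)
    then show "C o\<^sub>L (sqrt r *\<^sub>R D) = (sqrt r *\<^sub>R D) o\<^sub>L C" by (simp add: scl scr)
  qed
qed

text \<open>
  A positive square root \<open>Q\<close> commutes with \<open>Q o Q\<close>, hence with the root \<open>D\<close> just constructed; then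
  \<open>(D - Q) o (D + Q) o (D - Q) = 0\<close> is a sum of two positive operators, so both vanish.
\<close>

lemma positive_sqrt_unique:
  assumes Q: "positive_op Q" and Q': "positive_op Q'" and eq: "Q o\<^sub>L Q = Q' o\<^sub>L Q'"
  shows "Q = Q'"
proof -
  have pos: "positive_op (Q o\<^sub>L Q)"
    using positive_op_adj_compose[OF positive_op_in[OF Q]] by (simp add: positive_op_adj[OF Q])
  obtain D where D: "positive_op D" "D o\<^sub>L D = Q o\<^sub>L Q"
    "\<And>C. C o\<^sub>L (Q o\<^sub>L Q) = (Q o\<^sub>L Q) o\<^sub>L C \<Longrightarrow> C o\<^sub>L D = D o\<^sub>L C"
    by (rule positive_sqrt[OF pos]) blast
  have "R = D" if R: "positive_op R" and RQ: "R o\<^sub>L R = Q o\<^sub>L Q" for R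
  proof -
    have "R o\<^sub>L D = D o\<^sub>L R"
      by (rule D(3)) (intro blinfun_eqI, simp flip: RQ)
    then have com: "R (D x) = D (R x)" for x by (metis blinfun_compose.rep_eq comp_apply)
    have sq: "D (D x) = R (R x)" for x
      using D(2) RQ by (metis blinfun_compose.rep_eq comp_apply)
    have "D x - R x = 0" for x
    proof -
      define u where "u = D x - R x"
      have "D u + R u = 0"
        by (simp add: u_def blinfun.diff_right com sq)
      then have s: "Re (cinner u (D u)) + Re (cinner u (R u)) = 0"
        by (metis cinner_add_right cinner.zero_right plus_complex.simps(1) zero_complex.simps(1))
      have "Re (cinner u (D u)) = 0" "Re (cinner u (R u)) = 0"
        using s positive_op_Re[OF D(1), of u] positive_op_Re[OF R, of u] by linarith+
      then have "D u = 0" "R u = 0" using D(1) R positive_op_null by blast+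
      then have "cinner x (D u - R u) = 0" by (simp add: cinner.zero_right)
      moreover have "cinner x (D u - R u) = cinner u u"
        by (simp add: u_def cinner_diff_left cinner_diff_right blinfun.diff_right
            positive_op_selfadjoint[OF D(1)] positive_op_selfadjoint[OF R])
      ultimately have "u = 0" by (simp add: cinner_self)
      then show ?thesis by (simp add: u_def)
    qed
    then show ?thesis by (intro blinfun_eqI) simp
  qed
  then show ?thesis using Q Q' eq by metis
qed

lemma abs_op_eqI:
  assumes "positive_op P" "P o\<^sub>L P = adj_op T o\<^sub>L T"
  shows "abs_op T = P"
  unfolding abs_op_def
proof (rule the_equality)
  show "Q = P" if "positive_op Q \<and> Q o\<^sub>L Q = adj_op T o\<^sub>L T" for Q
    by (rule positive_sqrt_unique) (use that assms in simp_all)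
qed (use assms in simp)

lemma abs_op_positive_compose:
  assumes "T \<in> bounded_ops"
  shows "positive_op (abs_op T)" "abs_op T o\<^sub>L abs_op T = adj_op T o\<^sub>L T"
proof -
  obtain D where "positive_op D" "D o\<^sub>L D = adj_op T o\<^sub>L T"
    by (rule positive_sqrt[OF positive_op_adj_compose[OF assms]], rule that)
  moreover from this have "abs_op T = D" by (rule abs_op_eqI)
  ultimately show "positive_op (abs_op T)" "abs_op T o\<^sub>L abs_op T = adj_op T o\<^sub>L T"
    by simp_all
qed

lemma abs_op_of_positive: "positive_op P \<Longrightarrow> abs_op P = P"
  by (intro abs_op_eqI) (simp_all add: positive_op_adj)

lemma cinner_abs_op:
  assumes "T \<in> bounded_ops"
  shows "cinner (abs_op T x) (abs_op T y) = cinner (T x) (T y)"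
proof -
  have "cinner (abs_op T x) (abs_op T y) = cinner x (abs_op T (abs_op T y))"
    by (rule positive_op_selfadjoint[OF abs_op_positive_compose(1)[OF assms]])
  also have "abs_op T (abs_op T y) = adj_op T (T y)"
    using abs_op_positive_compose(2)[OF assms] by (metis blinfun_compose.rep_eq comp_apply)
  finally show ?thesis by (simp add: cinner_adj_right assms)
qed

text \<open>
  The adjoint of the partial isometry is obtained from the form \<open>(y, abs_op T x) \<mapsto> cinner y (T x)\<close>,
  which is well defined on the range of \<open>abs_op T\<close> because \<open>abs_op T x\<close> and \<open>T x\<close> have equal norms.
\<close>

lemma polar_decomposition:
  assumes T: "T \<in> bounded_ops"
  obtains U where "U \<in> bounded_ops" "T = U o\<^sub>L abs_op T" "abs_op T = adj_op U o\<^sub>L T"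
proof -
  define P where "P = abs_op T"
  have P: "positive_op P" unfolding P_def by (rule abs_op_positive_compose(1)[OF T])
  note Pop = positive_op_in[OF P]
  have PT: "cinner (P x) (P y) = cinner (T x) (T y)" for x y
    unfolding P_def by (rule cinner_abs_op[OF T])
  have nPT: "norm (P x) = norm (T x)" for x
    using PT[of x x] by (simp add: cinner_self power2_eq_iff_nonneg flip: of_real_power)
  define M where "M = range (blinfun_apply P)"
  have M: "csubspace M"
    unfolding csubspace_def M_def
  proof (intro conjI ballI allI)
    show "0 \<in> range (blinfun_apply P)" by (metis blinfun.zero_right rangeI)
    show "x + y \<in> range (blinfun_apply P)" if "x \<in> range (blinfun_apply P)" "y \<in> range (blinfun_apply P)" for x y
      using that by (auto simp flip: blinfun.add_right)
    show "c *\<^sub>C x \<in> range (blinfun_apply P)" if "x \<in> range (blinfun_apply P)" for c x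
      using that by (auto simp flip: bounded_ops_scaleC[OF Pop])
  qed
  \<comment> \<open>the map \<open>P x \<mapsto> T x\<close>\<close>
  define g where "g m = T (SOME x. P x = m)" for m
  have g: "g (P x) = T x" for x
  proof -
    define x' where "x' = (SOME x'. P x' = P x)"
    have "P x' = P x" unfolding x'_def by (rule someI) simp
    then have "norm (T (x' - x)) = 0" unfolding nPT[symmetric] by (simp add: blinfun.diff_right)
    then have "T x' = T x" by (simp add: blinfun.diff_right)
    then show ?thesis by (simp add: g_def x'_def)
  qed
  have gadd: "g (m + n) = g m + g n" if "m \<in> M" "n \<in> M" for m n
    using that g[of "_ + _"] by (auto simp: M_def g blinfun.add_right)
  have gsc: "g (c *\<^sub>C m) = c *\<^sub>C g m" if "m \<in> M" for m c
    using that g[of "c *\<^sub>C _"] by (auto simp: M_def g bounded_ops_scaleC[OF T] bounded_ops_scaleC[OF Pop])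
  have gn: "cmod (cinner y (g m)) \<le> 1 * norm y * norm m" if "m \<in> M" for y m
    using that cauchy_schwarz[of y "g m"] by (auto simp: M_def g nPT)
  obtain W where W: "W \<in> bounded_ops" "\<And>y. blinfun_apply W y \<in> closure M"
      "\<And>y m. m \<in> M \<Longrightarrow> cinner (blinfun_apply W y) m = cinner y (g m)"
    by (rule sesquilinear_operator[OF M, of 1 "\<lambda>y m. cinner y (g m)"])
       (simp_all add: cinner_simps gadd gsc gn[simplified])
  have WP: "cinner (W y) (P x) = cinner y (T x)" for x y
    using W(3)[of "P x" y] by (simp add: M_def g)
  show ?thesis
  proof (rule that[of "adj_op W"])
    show "adj_op W \<in> bounded_ops" using W(1) by blast
    show "T = adj_op W o\<^sub>L abs_op T"
      by (intro bounded_ops_eqI) (simp add: cinner_adj_right W(1) WP flip: P_def)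
    have "W (T x) - P x = 0" for x
    proof (rule orthogonal_closure_zero)
      obtain s where s: "\<And>n::nat. s n \<in> M" "s \<longlonglongrightarrow> W (T x)"
        using W(2)[of "T x"] by (auto simp: closure_sequential)
      have "\<And>n. s n - P x \<in> M"
        using s(1) by (auto simp: M_def image_iff) (metis blinfun.diff_right)
      moreover have "(\<lambda>n. s n - P x) \<longlonglongrightarrow> W (T x) - P x" using s(2) by (intro tendsto_intros)
      ultimately show "W (T x) - P x \<in> closure M"
        unfolding closure_sequential by (intro exI[of _ "\<lambda>n. s n - P x"]) auto
      show "cinner (W (T x) - P x) m = 0" if "m \<in> M" for m
        using that by (auto simp: M_def cinner_simps WP PT)
    qed
    then show "abs_op T = adj_op (adj_op W) o\<^sub>L T"
      by (intro blinfun_eqI) (simp add: W(1) flip: P_def)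
  qed
qed

section \<open>Orthonormal bases\<close>

definition orthonormal :: "'a::complex_hilbert set \<Rightarrow> bool" where
  "orthonormal E \<longleftrightarrow> (\<forall>e\<in>E. \<forall>f\<in>E. cinner e f = (if e = f then 1 else 0))"

lemma is_onb_orthonormal: "is_onb E \<Longrightarrow> orthonormal E"
  by (simp add: is_onb_def orthonormal_def)

lemma ex_onb: "\<exists>E :: 'a::complex_hilbert set. is_onb E"
proof -
  have "\<exists>E\<in>Collect orthonormal. \<forall>X\<in>Collect orthonormal. E \<subseteq> X \<longrightarrow> X = (E :: 'a set)"
  proof (rule subset_Zorn_nonempty)
    show "Collect orthonormal \<noteq> ({} :: 'a set set)"
      using orthonormal_def by (metis empty_iff mem_Collect_eq)
    fix \<C> :: "'a set set" assume "\<C> \<noteq> {}" and C: "subset.chain (Collect orthonormal) \<C>"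
    show "\<Union>\<C> \<in> Collect orthonormal"
      unfolding orthonormal_def
    proof (intro CollectI ballI)
      fix e f assume "e \<in> \<Union>\<C>" "f \<in> \<Union>\<C>"
      then obtain X Y where XY: "X \<in> \<C>" "Y \<in> \<C>" "e \<in> X" "f \<in> Y" by auto
      then have "X \<subseteq> Y \<or> Y \<subseteq> X" using C by (auto simp: subset_chain_def)
      then have "\<exists>Z\<in>\<C>. e \<in> Z \<and> f \<in> Z" using XY by auto
      moreover have "\<And>Z. Z \<in> \<C> \<Longrightarrow> orthonormal Z" using C by (auto simp: subset_chain_def)
      ultimately show "cinner e f = (if e = f then 1 else 0)" unfolding orthonormal_def by blast
    qed
  qed
  then obtain E :: "'a set" where E: "orthonormal E" and max: "\<And>X. orthonormal X \<Longrightarrow> E \<subseteq> X \<Longrightarrow> X = E"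
    by auto
  have "x = 0" if x: "\<forall>e\<in>E. cinner e x = 0" for x
  proof (rule ccontr)
    assume "x \<noteq> 0"
    define u where "u = inverse (norm x) *\<^sub>R x"
    have u1: "cinner u u = 1" using \<open>x \<noteq> 0\<close> by (simp add: cinner_self u_def)
    have ue: "cinner e u = 0" if "e \<in> E" for e using x that by (simp add: u_def cinner_scaleR_right)
    have eu: "cinner u e = 0" if "e \<in> E" for e
      using ue[OF that] cinner_commute[of u e] by simp
    have "orthonormal (insert u E)"
      using E u1 ue eu unfolding orthonormal_def by auto
    then have "u \<in> E" using max by blast
    then show False using ue u1 by force
  qed
  then show ?thesis using E unfolding is_onb_def orthonormal_def by blast
qed

definition ortho_remainder :: "'a::complex_hilbert set \<Rightarrow> 'a \<Rightarrow> 'a" where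
  "ortho_remainder F x = x - (\<Sum>e\<in>F. cinner e x *\<^sub>C e)"

lemma scaleC_diff_left: "(a - b) *\<^sub>C x = a *\<^sub>C x - b *\<^sub>C x"
  using scaleC_add_left[of "a - b" b x] by simp

lemma scaleC_sum_right: "c *\<^sub>C (\<Sum>i\<in>I. f i) = (\<Sum>i\<in>I. c *\<^sub>C f i)"
  using bounded_linear_scaleC[of c] by (metis bounded_linear.linear linear_sum)

lemma ortho_remainder_diff: "ortho_remainder F (x - y) = ortho_remainder F x - ortho_remainder F y"
  by (simp add: ortho_remainder_def cinner_simps scaleC_diff_left sum_subtractf)

lemma ortho_remainder_add: "ortho_remainder F (x + y) = ortho_remainder F x + ortho_remainder F y"
  by (simp add: ortho_remainder_def cinner_simps scaleC_add_left sum.distrib)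

lemma ortho_remainder_scaleC: "ortho_remainder F (c *\<^sub>C x) = c *\<^sub>C ortho_remainder F x"
  by (simp add: ortho_remainder_def cinner_simps scaleC_diff_right scaleC_sum_right scaleC_scaleC)

lemma norm_ortho_remainder:
  assumes E: "orthonormal E" "finite F" "F \<subseteq> E"
  shows "(norm (ortho_remainder F x))\<^sup>2 = (norm x)\<^sup>2 - (\<Sum>e\<in>F. (cmod (cinner e x))\<^sup>2)"
proof -
  define s where "s = (\<Sum>e\<in>F. cinner e x *\<^sub>C e)"
  have es: "cinner f s = cinner f x" if "f \<in> F" for f
  proof -
    have "cinner f s = (\<Sum>e\<in>F. cinner e x * (if f = e then 1 else 0))"
      unfolding s_def cinner.sum_right cinner_scaleC_right
    proof (rule sum.cong[OF refl])
      fix e assume "e \<in> F"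
      then have "f \<in> E" "e \<in> E" using E(3) that by blast+
      then have "cinner f e = (if f = e then 1 else 0)" using E(1) unfolding orthonormal_def by blast
      then show "cinner e x * cinner f e = cinner e x * (if f = e then 1 else 0)" by (rule arg_cong)
    qed
    then show ?thesis using that E(2) by (simp add: if_distrib cong: if_cong)
  qed
  have sx: "cinner s y = (\<Sum>e\<in>F. cnj (cinner e x) * cinner e y)" for y
    by (simp add: s_def cinner.sum_left cinner_scaleC_left)
  have "cinner s x = of_real (\<Sum>e\<in>F. (cmod (cinner e x))\<^sup>2)"
    unfolding sx of_real_sum complex_norm_square by (simp add: mult.commute)
  moreover have "cinner s s = cinner s x"
    unfolding sx using es by (intro sum.cong refl) simp
  ultimately have "(norm s)\<^sup>2 = (\<Sum>e\<in>F. (cmod (cinner e x))\<^sup>2)"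
    and "Re (cinner s x) = (\<Sum>e\<in>F. (cmod (cinner e x))\<^sup>2)"
    unfolding norm_sq_eq by (metis Re_complex_of_real)+
  moreover have "Re (cinner x s) = Re (cinner s x)" by (metis cinner_commute cnj.simps(1))
  ultimately show ?thesis unfolding ortho_remainder_def s_def[symmetric] by (simp add: norm_diff_sq)
qed

lemma bessel:
  assumes "orthonormal E" "finite F" "F \<subseteq> E"
  shows "(\<Sum>e\<in>F. (cmod (cinner e x))\<^sup>2) \<le> (norm x)\<^sup>2"
  using norm_ortho_remainder[OF assms, of x] zero_le_power2[of "norm (ortho_remainder F x)"] by linarith

lemma norm_ortho_remainder_mono:
  assumes "orthonormal E" "finite G" "G \<subseteq> E" "F \<subseteq> G"
  shows "norm (ortho_remainder G x) \<le> norm (ortho_remainder F x)"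
proof (rule power2_le_imp_le)
  have F: "finite F" "F \<subseteq> E" using assms by (auto intro: finite_subset)
  have "(\<Sum>e\<in>F. (cmod (cinner e x))\<^sup>2) \<le> (\<Sum>e\<in>G. (cmod (cinner e x))\<^sup>2)"
    using assms by (intro sum_mono2) auto
  then show "(norm (ortho_remainder G x))\<^sup>2 \<le> (norm (ortho_remainder F x))\<^sup>2"
    by (simp add: norm_ortho_remainder[OF assms(1) F] norm_ortho_remainder[OF assms(1-3)])
qed simp

text \<open>
  The vectors whose Fourier expansion along \<open>E\<close> converges to them form a closed subspace that
  contains \<open>E\<close>; projecting onto it leaves a rest orthogonal to \<open>E\<close>, which is zero.
\<close>

lemma onb_approx:
  assumes E: "is_onb E" and "\<epsilon> > 0"
  obtains F where "finite F" "F \<subseteq> E" "norm (ortho_remainder F x) < \<epsilon>"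
proof -
  note oE = is_onb_orthonormal[OF E]
  define M where "M = {x. \<forall>\<epsilon>>0. \<exists>F. finite F \<and> F \<subseteq> E \<and> norm (ortho_remainder F x) < \<epsilon>}"
  have contr: "norm (ortho_remainder F x) \<le> norm x" if "finite F" "F \<subseteq> E" for F x
    using norm_ortho_remainder_mono[OF oE that, of "{}" x] by (simp add: ortho_remainder_def)
  have M: "csubspace M"
    unfolding csubspace_def
  proof (intro conjI ballI allI)
    show "0 \<in> M" by (auto simp: M_def ortho_remainder_def intro!: exI[of _ "{}"])
  next
    fix x y assume xy: "x \<in> M" "y \<in> M"
    show "x + y \<in> M"
      unfolding M_def
    proof (intro CollectI allI impI)
      fix \<epsilon> :: real assume e: "\<epsilon> > 0"
      obtain F G where F: "finite F" "F \<subseteq> E" "norm (ortho_remainder F x) < \<epsilon>/2"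
        and G: "finite G" "G \<subseteq> E" "norm (ortho_remainder G y) < \<epsilon>/2"
        using xy half_gt_zero[OF e] unfolding M_def mem_Collect_eq by meson
      have "norm (ortho_remainder (F \<union> G) x) < \<epsilon>/2" "norm (ortho_remainder (F \<union> G) y) < \<epsilon>/2"
        using norm_ortho_remainder_mono[OF oE, of "F \<union> G" F x]
          norm_ortho_remainder_mono[OF oE, of "F \<union> G" G y] F G by auto
      then have "norm (ortho_remainder (F \<union> G) (x + y)) < \<epsilon>"
        unfolding ortho_remainder_add
        using norm_triangle_ineq[of "ortho_remainder (F \<union> G) x" "ortho_remainder (F \<union> G) y"] by linarith
      then show "\<exists>F. finite F \<and> F \<subseteq> E \<and> norm (ortho_remainder F (x + y)) < \<epsilon>"
        using F G by (intro exI[of _ "F \<union> G"]) auto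
    qed
  next
    fix c x assume x: "x \<in> M"
    show "c *\<^sub>C x \<in> M"
      unfolding M_def
    proof (intro CollectI allI impI)
      fix \<epsilon> :: real assume e: "\<epsilon> > 0"
      have p: "\<epsilon> / (cmod c + 1) > 0" using e by (simp add: add_nonneg_pos)
      then obtain F where F: "finite F" "F \<subseteq> E" "norm (ortho_remainder F x) < \<epsilon> / (cmod c + 1)"
        using x unfolding M_def by blast
      have "cmod c * norm (ortho_remainder F x) \<le> (cmod c + 1) * norm (ortho_remainder F x)"
        by (intro mult_right_mono) auto
      also have "\<dots> < \<epsilon>" using F(3) pos_less_divide_eq[of "cmod c + 1"] norm_ge_zero[of c]
        by (simp add: mult.commute)
      finally show "\<exists>F. finite F \<and> F \<subseteq> E \<and> norm (ortho_remainder F (c *\<^sub>C x)) < \<epsilon>"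
        using F by (intro exI[of _ F]) (auto simp: ortho_remainder_scaleC norm_scaleC)
    qed
  qed
  have cl: "w \<in> M" if w: "w \<in> closure M" for w
    unfolding M_def
  proof (intro CollectI allI impI)
    fix \<epsilon> :: real assume e: "\<epsilon> > 0"
    obtain m where m: "m \<in> M" "dist m w < \<epsilon>/2" using w half_gt_zero[OF e] unfolding closure_approachable by blast
    obtain F where F: "finite F" "F \<subseteq> E" "norm (ortho_remainder F m) < \<epsilon>/2"
      using m(1) half_gt_zero[OF e] unfolding M_def mem_Collect_eq by meson
    have "ortho_remainder F w = ortho_remainder F m + ortho_remainder F (w - m)"
      by (simp add: ortho_remainder_diff)
    then have "norm (ortho_remainder F w) \<le> norm (ortho_remainder F m) + norm (ortho_remainder F (w - m))"
      by (metis norm_triangle_ineq)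
    also have "\<dots> < \<epsilon>"
      using F(3) contr[OF F(1,2), of "w - m"] m(2) by (simp add: dist_norm norm_minus_commute)
    finally show "\<exists>F. finite F \<and> F \<subseteq> E \<and> norm (ortho_remainder F w) < \<epsilon>" using F by blast
  qed
  obtain w where w: "w \<in> closure M" "\<And>m. m \<in> M \<Longrightarrow> cinner w m = cinner x m"
    by (rule riesz_subspace[OF M, of "\<lambda>m. cinner x m" "norm x"])
       (auto simp: cinner_simps cauchy_schwarz)
  have "e \<in> M" if "e \<in> E" for e
  proof -
    have "cinner e e = 1" using that oE by (auto simp: orthonormal_def)
    then have "ortho_remainder {e} e = 0" by (simp add: ortho_remainder_def)
    then show ?thesis using that by (auto simp: M_def intro!: exI[of _ "{e}"])
  qed
  then have "cinner e (x - w) = 0" if "e \<in> E" for e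
    using w(2)[of e] that by (metis cinner_commute cinner_diff_right eq_iff_diff_eq_0)
  then have "x = w" using E unfolding is_onb_def by (metis eq_iff_diff_eq_0)
  then have "x \<in> M" using w cl by blast
  then show ?thesis using \<open>\<epsilon> > 0\<close> that unfolding M_def by blast
qed

lemma parseval:
  assumes E: "is_onb E"
  shows "((\<lambda>e. (cmod (cinner e x))\<^sup>2) has_sum (norm x)\<^sup>2) E"
  unfolding has_sum_def tendsto_iff eventually_finite_subsets_at_top
proof (intro allI impI)
  note oE = is_onb_orthonormal[OF E]
  fix \<epsilon> :: real assume e: "\<epsilon> > 0"
  obtain F where F: "finite F" "F \<subseteq> E" "norm (ortho_remainder F x) < sqrt \<epsilon>"
    by (rule onb_approx[OF E, of "sqrt \<epsilon>" x]) (use e in auto)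
  have "dist (\<Sum>e\<in>G. (cmod (cinner e x))\<^sup>2) ((norm x)\<^sup>2) < \<epsilon>"
    if "finite G" "F \<subseteq> G" "G \<subseteq> E" for G
  proof -
    have "norm (ortho_remainder G x) < sqrt \<epsilon>"
      using norm_ortho_remainder_mono[OF oE that(1,3,2), of x] F(3) by linarith
    then have "(norm (ortho_remainder G x))\<^sup>2 < (sqrt \<epsilon>)\<^sup>2"
      by (intro power_strict_mono) auto
    then have "(norm (ortho_remainder G x))\<^sup>2 < \<epsilon>" using e by simp
    then show ?thesis
      using norm_ortho_remainder[OF oE that(1,3), of x] bessel[OF oE that(1,3), of x]
      by (simp add: dist_real_def)
  qed
  then show "\<exists>X. finite X \<and> X \<subseteq> E \<and> (\<forall>Y. finite Y \<and> X \<subseteq> Y \<and> Y \<subseteq> E \<longrightarrow>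
      dist (\<Sum>e\<in>Y. (cmod (cinner e x))\<^sup>2) ((norm x)\<^sup>2) < \<epsilon>)"
    using F by blast
qed


section \<open>Hilbert-Schmidt operators\<close>

definition hilbert_schmidt :: "('a::complex_hilbert \<Rightarrow>\<^sub>L 'a) \<Rightarrow> bool" where
  "hilbert_schmidt B \<longleftrightarrow> B \<in> bounded_ops \<and> (\<exists>E. is_onb E \<and> (\<lambda>e. (norm (B e))\<^sup>2) summable_on E)"

text \<open>The squared Hilbert-Schmidt norm; see \<open>hs_has_sum\<close> for its independence of the basis.\<close>

definition hs_sum :: "('a::complex_hilbert \<Rightarrow>\<^sub>L 'a) \<Rightarrow> real" where
  "hs_sum B = (\<Sum>\<^sub>\<infinity>e\<in>(SOME E. is_onb E). (norm (B e))\<^sup>2)"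

lemma hs_in: "hilbert_schmidt B \<Longrightarrow> B \<in> bounded_ops"
  by (simp add: hilbert_schmidt_def)

lemma has_sum_finite_sum:
  fixes f :: "'i \<Rightarrow> 'b \<Rightarrow> 'c::topological_comm_monoid_add"
  assumes "\<And>i. i \<in> I \<Longrightarrow> (f i has_sum s i) A"
  shows "((\<lambda>x. \<Sum>i\<in>I. f i x) has_sum (\<Sum>i\<in>I. s i)) A"
  using assms by (induction I rule: infinite_finite_induct) (auto intro!: has_sum_add)

text \<open>
  Expanding \<open>norm (adj_op B f) ^ 2\<close> in \<open>E\<close> by Parseval and exchanging a finite with an infinite sum
  bounds the partial sums over \<open>F\<close> by Bessel's inequality, without a double series.
\<close>

lemma hs_adjoint_le:
  assumes B: "B \<in> bounded_ops" and E: "is_onb E" and F: "is_onb F"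
    and s: "((\<lambda>e. (norm (blinfun_apply B e))\<^sup>2) has_sum s) E"
  shows "(\<lambda>f. (norm (adj_op B f))\<^sup>2) summable_on F"
    and "(\<Sum>\<^sub>\<infinity>f\<in>F. (norm (adj_op B f))\<^sup>2) \<le> s"
proof -
  have fin: "(\<Sum>f\<in>G. (norm (adj_op B f))\<^sup>2) \<le> s" if G: "finite G" "G \<subseteq> F" for G
  proof (rule has_sum_mono)
    show "((\<lambda>e. \<Sum>f\<in>G. (cmod (cinner e (adj_op B f)))\<^sup>2) has_sum (\<Sum>f\<in>G. (norm (adj_op B f))\<^sup>2)) E"
      by (intro has_sum_finite_sum parseval E)
    have "cmod (cinner e (adj_op B f)) = cmod (cinner f (B e))" for e f
      by (metis B cinner_adj_right cinner_commute complex_mod_cnj)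
    then show "(\<Sum>f\<in>G. (cmod (cinner e (adj_op B f)))\<^sup>2) \<le> (norm (B e))\<^sup>2" for e
      using bessel[OF is_onb_orthonormal[OF F] G, of "B e"] by simp
  qed (rule s)
  then show sm: "(\<lambda>f. (norm (adj_op B f))\<^sup>2) summable_on F"
    by (intro nonneg_bdd_above_summable_on bdd_aboveI2[where M = s]) auto
  then show "(\<Sum>\<^sub>\<infinity>f\<in>F. (norm (adj_op B f))\<^sup>2) \<le> s"
    using fin by (rule infsum_le_finite_sums)
qed

lemma hs_adjoint: "hilbert_schmidt B \<Longrightarrow> hilbert_schmidt (adj_op B)"
  unfolding hilbert_schmidt_def using hs_adjoint_le(1) has_sum_infsum adj_op_in by blast

lemma hs_summable_any:
  assumes "hilbert_schmidt B" "is_onb F"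
  shows "(\<lambda>e. (norm (blinfun_apply B e))\<^sup>2) summable_on F"
proof -
  obtain E where "is_onb E" "(\<lambda>e. (norm (adj_op B e))\<^sup>2) summable_on E"
    using hs_adjoint[OF assms(1)] unfolding hilbert_schmidt_def by blast
  then show ?thesis
    using hs_adjoint_le(1)[OF adj_op_in[OF hs_in[OF assms(1)]] _ assms(2) has_sum_infsum]
      adj_adj[OF hs_in[OF assms(1)]] by metis
qed

lemma some_onb: "is_onb (SOME E. is_onb E)"
  using ex_onb by (rule someI_ex)

lemma hs_adjoint_infsum:
  assumes B: "hilbert_schmidt B" and "is_onb E" "is_onb F"
  shows "(\<Sum>\<^sub>\<infinity>f\<in>F. (norm (adj_op B f))\<^sup>2) = (\<Sum>\<^sub>\<infinity>e\<in>E. (norm (B e))\<^sup>2)"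
proof (rule antisym)
  show "(\<Sum>\<^sub>\<infinity>f\<in>F. (norm (adj_op B f))\<^sup>2) \<le> (\<Sum>\<^sub>\<infinity>e\<in>E. (norm (B e))\<^sup>2)"
    using hs_adjoint_le(2)[OF hs_in[OF B] assms(2,3) has_sum_infsum[OF hs_summable_any[OF B assms(2)]]] .
  have B': "hilbert_schmidt (adj_op B)" using B by (rule hs_adjoint)
  show "(\<Sum>\<^sub>\<infinity>e\<in>E. (norm (B e))\<^sup>2) \<le> (\<Sum>\<^sub>\<infinity>f\<in>F. (norm (adj_op B f))\<^sup>2)"
    using hs_adjoint_le(2)[OF hs_in[OF B'] assms(3,2) has_sum_infsum[OF hs_summable_any[OF B' assms(3)]]]
    by (simp add: hs_in[OF B])
qed

lemma hs_has_sum: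
  assumes "hilbert_schmidt B" "is_onb E"
  shows "((\<lambda>e. (norm (blinfun_apply B e))\<^sup>2) has_sum hs_sum B) E"
    and "((\<lambda>e. (norm (adj_op B e))\<^sup>2) has_sum hs_sum B) E"
proof -
  have "(\<Sum>\<^sub>\<infinity>e\<in>E. (norm (B e))\<^sup>2) = hs_sum B" "(\<Sum>\<^sub>\<infinity>e\<in>E. (norm (adj_op B e))\<^sup>2) = hs_sum B"
    unfolding hs_sum_def
    using hs_adjoint_infsum[OF assms(1)] assms(2) some_onb by metis+
  then show "((\<lambda>e. (norm (blinfun_apply B e))\<^sup>2) has_sum hs_sum B) E"
    "((\<lambda>e. (norm (adj_op B e))\<^sup>2) has_sum hs_sum B) E"
    using hs_summable_any[OF assms] hs_summable_any[OF hs_adjoint[OF assms(1)] assms(2)]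
    by (simp_all add: has_sum_iff)
qed

lemma hs_add:
  assumes "hilbert_schmidt B" "hilbert_schmidt C"
  shows "hilbert_schmidt (B + C)"
proof -
  define E :: "'a set" where "E = (SOME E. is_onb E)"
  have E: "is_onb E" unfolding E_def by (rule some_onb)
  have "(\<lambda>e. (norm ((B + C) e))\<^sup>2) summable_on E"
  proof (rule summable_on_comparison_test)
    show "(\<lambda>e. 2 * (norm (B e))\<^sup>2 + 2 * (norm (C e))\<^sup>2) summable_on E"
      by (intro summable_on_add summable_on_cmult_right hs_summable_any assms E)
    fix e
    have "(norm ((B + C) e))\<^sup>2 \<le> (norm (B e) + norm (C e))\<^sup>2"
      by (intro power_mono) (auto simp: blinfun.add_left norm_triangle_ineq)
    also have "\<dots> \<le> 2 * (norm (B e))\<^sup>2 + 2 * (norm (C e))\<^sup>2"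
      using zero_le_power2[of "norm (B e) - norm (C e)"] by (simp add: power2_diff power2_sum)
    finally show "(norm ((B + C) e))\<^sup>2 \<le> 2 * (norm (B e))\<^sup>2 + 2 * (norm (C e))\<^sup>2" .
  qed simp
  then show ?thesis unfolding hilbert_schmidt_def using E assms hs_in by blast
qed

lemma hs_compose_left:
  assumes "hilbert_schmidt B" "S \<in> bounded_ops"
  shows "hilbert_schmidt (S o\<^sub>L B)"
proof -
  define E :: "'a set" where "E = (SOME E. is_onb E)"
  have E: "is_onb E" unfolding E_def by (rule some_onb)
  have "(\<lambda>e. (norm ((S o\<^sub>L B) e))\<^sup>2) summable_on E"
  proof (rule summable_on_comparison_test)
    show "(\<lambda>e. (norm S)\<^sup>2 * (norm (B e))\<^sup>2) summable_on E"
      by (intro summable_on_cmult_right hs_summable_any assms E)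
    show "(norm ((S o\<^sub>L B) e))\<^sup>2 \<le> (norm S)\<^sup>2 * (norm (B e))\<^sup>2" for e
      using power_mono[OF norm_blinfun[of S "B e"], of 2] by (simp add: power_mult_distrib)
  qed simp
  then show ?thesis unfolding hilbert_schmidt_def using E assms hs_in by blast
qed

lemma hs_compose_right:
  assumes "hilbert_schmidt B" "S \<in> bounded_ops"
  shows "hilbert_schmidt (B o\<^sub>L S)"
proof -
  have "hilbert_schmidt (adj_op (adj_op S o\<^sub>L adj_op B))"
    by (intro hs_adjoint hs_compose_left adj_op_in assms)
  then show ?thesis using assms by (simp add: adj_compose adj_op_in hs_in)
qed

lemma hs_scaleC_op:
  assumes "hilbert_schmidt B"
  shows "hilbert_schmidt (c *\<^sub>O B)"
proof -
  have "c *\<^sub>O B = (c *\<^sub>O id_blinfun) o\<^sub>L B"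
    by (intro blinfun_eqI) (simp add: scaleC_op.rep_eq)
  then show ?thesis using hs_compose_left[OF assms] by auto
qed

lemma cinner_polarization:
  "cinner x y = (1/4) * (of_real ((norm (x + y))\<^sup>2) - of_real ((norm (x + (-1) *\<^sub>C y))\<^sup>2)
     - \<i> * of_real ((norm (x + \<i> *\<^sub>C y))\<^sup>2) + \<i> * of_real ((norm (x + (-\<i>) *\<^sub>C y))\<^sup>2))"
  by (simp add: norm_add_sq norm_scaleC cinner_simps complex_eq_iff)

lemma has_sum_polarization:
  fixes p q r s :: "'b \<Rightarrow> real"
  assumes "(p has_sum P) E" "(q has_sum Q) E" "(r has_sum R) E" "(s has_sum S) E"
  shows "((\<lambda>e. (1/4) * (of_real (p e) - of_real (q e) - \<i> * of_real (r e) + \<i> * of_real (s e)))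
     has_sum (1/4) * (of_real P - of_real Q - \<i> * of_real R + \<i> * of_real S)) E"
proof -
  have "((\<lambda>e. (1/4) * (of_real (p e) + (-1) * of_real (q e) + (-\<i>) * of_real (r e) + \<i> * of_real (s e)))
     has_sum (1/4) * (of_real P + (-1) * of_real Q + (-\<i>) * of_real R + \<i> * of_real S)) E"
    using assms by (intro has_sum_cmult_right has_sum_add has_sum_of_real)
  then show ?thesis by simp
qed

text \<open>
  Polarising the invariance of \<open>hs_sum\<close> under \<open>adj_op\<close> and under change of basis.  This is the source
  of the basis independence and of the cyclicity of the trace.
\<close>

lemma hs_cinner_has_sum:
  assumes B: "hilbert_schmidt B" and C: "hilbert_schmidt C"
  obtains s where "\<And>E. is_onb E \<Longrightarrow> ((\<lambda>e. cinner (blinfun_apply B e) (C e)) has_sum s) E"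
    "\<And>E. is_onb E \<Longrightarrow> ((\<lambda>e. cinner (adj_op C e) (adj_op B e)) has_sum s) E"
proof -
  define N where "N c = B + c *\<^sub>O C" for c
  have N: "hilbert_schmidt (N c)" for c unfolding N_def by (intro hs_add hs_scaleC_op B C)
  have Nap: "N c x = B x + c *\<^sub>C C x" for c x
    by (simp add: N_def blinfun.add_left scaleC_op.rep_eq)
  have Nadj: "adj_op (N c) x = adj_op B x + cnj c *\<^sub>C adj_op C x" for c x
    using hs_in[OF B] hs_in[OF C]
    by (simp add: N_def adj_add adj_scaleC_op bounded_ops_scaleC_op blinfun.add_left scaleC_op.rep_eq)
  define s where "s = (1/4) * (of_real (hs_sum (N 1)) - of_real (hs_sum (N (-1)))
      - \<i> * of_real (hs_sum (N \<i>)) + \<i> * of_real (hs_sum (N (-\<i>))))"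
  show ?thesis
  proof (rule that[of s])
    fix E :: "'a set" assume E: "is_onb E"
    show "((\<lambda>e. cinner (blinfun_apply B e) (C e)) has_sum s) E"
      unfolding s_def cinner_polarization[of "blinfun_apply B _"]
      by (rule has_sum_polarization)
         (use hs_has_sum(1)[OF N E, of 1, unfolded Nap] hs_has_sum(1)[OF N E, of "-1", unfolded Nap]
             hs_has_sum(1)[OF N E, of "\<i>", unfolded Nap] hs_has_sum(1)[OF N E, of "-\<i>", unfolded Nap]
            in simp_all)
    have "((\<lambda>e. cinner (adj_op B e) (adj_op C e)) has_sum cnj s) E"
    proof -
      have "cnj s = (1/4) * (of_real (hs_sum (N 1)) - of_real (hs_sum (N (-1)))
        - \<i> * of_real (hs_sum (N (-\<i>))) + \<i> * of_real (hs_sum (N \<i>)))"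
        by (simp add: s_def)
      also have "((\<lambda>e. cinner (adj_op B e) (adj_op C e)) has_sum \<dots>) E"
        unfolding cinner_polarization[of "blinfun_apply (adj_op B) _"]
        by (rule has_sum_polarization)
          (use hs_has_sum(2)[OF N E, of 1, unfolded Nadj] hs_has_sum(2)[OF N E, of "-1", unfolded Nadj]
             hs_has_sum(2)[OF N E, of "\<i>", unfolded Nadj] hs_has_sum(2)[OF N E, of "-\<i>", unfolded Nadj]
            in simp_all)
      finally show ?thesis .
    qed
    then have "((\<lambda>e. cnj (cinner (adj_op B e) (adj_op C e))) has_sum cnj (cnj s)) E"
      by (simp only: has_sum_cnj_iff)
    then show "((\<lambda>e. cinner (adj_op C e) (adj_op B e)) has_sum s) E" by simp
  qed
qed

lemma parseval_cinner:
  assumes E: "is_onb E"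
  shows "((\<lambda>e. cinner x e * cinner e y) has_sum cinner x y) E"
proof -
  have pol: "cnj a * b = (1/4) * (of_real ((cmod (a + b))\<^sup>2) - of_real ((cmod (a + (-1) * b))\<^sup>2)
     - \<i> * of_real ((cmod (a + \<i> * b))\<^sup>2) + \<i> * of_real ((cmod (a + (-\<i>) * b))\<^sup>2))" for a b
    by (simp add: complex_eq_iff cmod_power2) (simp add: power2_eq_square algebra_simps)
  have "((\<lambda>e. cnj (cinner e x) * cinner e y) has_sum cinner x y) E"
    unfolding pol cinner_polarization[of x y]
    by (rule has_sum_polarization)
       (use parseval[OF E, of "x + y"] parseval[OF E, of "x + (-1) *\<^sub>C y"]
           parseval[OF E, of "x + \<i> *\<^sub>C y"] parseval[OF E, of "x + (-\<i>) *\<^sub>C y"]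
          in \<open>simp_all add: cinner_add_right cinner_scaleC_right\<close>)
  then show ?thesis by simp
qed

section \<open>Trace-class operators and the trace\<close>

lemma trace_class_in: "T \<in> trace_class \<Longrightarrow> T \<in> bounded_ops"
  by (simp add: trace_class_def)

lemma positive_op_hs_root:
  assumes P: "positive_op P" and E: "is_onb E" "(\<lambda>e. cinner e (blinfun_apply P e)) summable_on E"
  obtains D where "positive_op D" "D o\<^sub>L D = P" "hilbert_schmidt D"
proof -
  obtain D where D: "positive_op D" "D o\<^sub>L D = P"
    by (rule positive_sqrt[OF P], rule that)
  have "Re (cinner e (P e)) = (norm (D e))\<^sup>2" for e
    using positive_op_selfadjoint[OF D(1), of e "D e"] D(2) by (auto simp: norm_sq_eq)
  then have "(\<lambda>e. (norm (D e))\<^sup>2) summable_on E"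
    using summable_on_Re[OF E(2)] by simp
  then have "hilbert_schmidt D"
    unfolding hilbert_schmidt_def using D(1) E(1) positive_op_in by blast
  then show ?thesis using that D by blast
qed

lemma trace_class_factor:
  assumes "T \<in> trace_class"
  obtains B C where "hilbert_schmidt B" "hilbert_schmidt C" "T = adj_op B o\<^sub>L C"
proof -
  obtain E where T: "T \<in> bounded_ops" and E: "is_onb E" "(\<lambda>e. cinner e (abs_op T e)) summable_on E"
    using assms by (auto simp: trace_class_def)
  obtain D where D: "D o\<^sub>L D = abs_op T" "hilbert_schmidt D"
    by (rule positive_op_hs_root[OF abs_op_positive_compose(1)[OF T] E], rule that)
  obtain U where U: "U \<in> bounded_ops" "T = U o\<^sub>L abs_op T"
    by (rule polar_decomposition[OF T], rule that)
  have UD: "hilbert_schmidt (U o\<^sub>L D)" by (rule hs_compose_left[OF D(2) U(1)])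
  have "T = (U o\<^sub>L D) o\<^sub>L D"
    by (subst U(2), subst D(1)[symmetric]) (rule blinfun_eqI, simp)
  also have "\<dots> = adj_op (adj_op (U o\<^sub>L D)) o\<^sub>L D"
    using hs_in[OF UD] by simp
  finally show ?thesis using that[OF hs_adjoint[OF UD] D(2)] by blast
qed

text \<open>
  A description in which \<open>abs_op\<close> no longer occurs, so that stability under sums becomes evident;
  the test operator that recovers \<open>abs_op T\<close> is the adjoint of the polar isometry.
\<close>

lemma trace_class_iff:
  "T \<in> trace_class \<longleftrightarrow> T \<in> bounded_ops \<and>
     (\<forall>V\<in>bounded_ops. \<forall>E. is_onb E \<longrightarrow> (\<lambda>e. cinner e (blinfun_apply V (T e))) summable_on E)"
proof (intro iffI conjI ballI allI impI)
  fix V :: "'a \<Rightarrow>\<^sub>L 'a" and E :: "'a set"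
  assume T: "T \<in> trace_class" and V: "V \<in> bounded_ops" and E: "is_onb E"
  obtain B C where BC: "hilbert_schmidt B" "hilbert_schmidt C" "T = adj_op B o\<^sub>L C"
    by (rule trace_class_factor[OF T], rule that)
  have "hilbert_schmidt (B o\<^sub>L adj_op V)" by (intro hs_compose_right BC adj_op_in V)
  then obtain s where s: "\<And>E. is_onb E \<Longrightarrow> ((\<lambda>e. cinner (blinfun_apply (B o\<^sub>L adj_op V) e) (C e)) has_sum s) E"
    using hs_cinner_has_sum[OF _ BC(2)] by metis
  have "cinner ((B o\<^sub>L adj_op V) e) (C e) = cinner e (V (T e))" for e
    using V hs_in[OF BC(1)] by (simp add: BC(3) cinner_adj_left flip: cinner_adj_right)
  then show "(\<lambda>e. cinner e (V (T e))) summable_on E"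
    using s[OF E] by (auto simp: summable_on_def)
next
  assume a: "T \<in> bounded_ops \<and>
     (\<forall>V\<in>bounded_ops. \<forall>E. is_onb E \<longrightarrow> (\<lambda>e. cinner e (blinfun_apply V (T e))) summable_on E)"
  obtain U where U: "U \<in> bounded_ops" "abs_op T = adj_op U o\<^sub>L T"
    using polar_decomposition a by metis
  have "(\<lambda>e. cinner e (adj_op U (T e))) summable_on (SOME E. is_onb E)"
    using a U(1) some_onb by blast
  then show "T \<in> trace_class"
    using a U(2) some_onb unfolding trace_class_def by auto
qed (rule trace_class_in)

lemma trace_class_add: "S \<in> trace_class \<Longrightarrow> T \<in> trace_class \<Longrightarrow> S + T \<in> trace_class"
  by (auto simp: trace_class_iff blinfun.add_left blinfun.add_right cinner_add_right
      intro!: summable_on_add)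

lemma trace_class_scaleC_op: "T \<in> trace_class \<Longrightarrow> c *\<^sub>O T \<in> trace_class"
  by (auto simp: trace_class_iff scaleC_op.rep_eq bounded_ops_scaleC cinner_scaleC_right
      intro!: summable_on_cmult_right)

lemma trace_class_zero: "0 \<in> trace_class"
  by (auto simp: trace_class_iff)

lemma trace_class_compose_left:
  assumes "T \<in> trace_class" "S \<in> bounded_ops"
  shows "S o\<^sub>L T \<in> trace_class"
  unfolding trace_class_iff
proof (intro conjI ballI allI impI)
  show "S o\<^sub>L T \<in> bounded_ops" using assms trace_class_in by blast
  fix V :: "'a \<Rightarrow>\<^sub>L 'a" and E :: "'a set" assume "V \<in> bounded_ops" "is_onb E"
  then have "(\<lambda>e. cinner e ((V o\<^sub>L S) (T e))) summable_on E"
    using assms unfolding trace_class_iff by blast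
  then show "(\<lambda>e. cinner e (V ((S o\<^sub>L T) e))) summable_on E" by simp
qed

lemma hs_product_trace:
  assumes B: "hilbert_schmidt B" and C: "hilbert_schmidt C"
  shows "adj_op B o\<^sub>L C \<in> trace_class"
    and "is_onb E \<Longrightarrow> ((\<lambda>e. cinner (blinfun_apply B e) (C e)) has_sum op_trace (adj_op B o\<^sub>L C)) E"
    and "is_onb E \<Longrightarrow> ((\<lambda>e. cinner (adj_op C e) (adj_op B e)) has_sum op_trace (adj_op B o\<^sub>L C)) E"
proof -
  show "adj_op B o\<^sub>L C \<in> trace_class"
    unfolding trace_class_iff
  proof (intro conjI ballI allI impI)
    show "adj_op B o\<^sub>L C \<in> bounded_ops" using B C hs_in by blast
    fix V :: "'a \<Rightarrow>\<^sub>L 'a" and E :: "'a set" assume V: "V \<in> bounded_ops" and E: "is_onb E"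
    have BV: "hilbert_schmidt (B o\<^sub>L adj_op V)" by (intro hs_compose_right B adj_op_in V)
    obtain s where "((\<lambda>e. cinner (blinfun_apply (B o\<^sub>L adj_op V) e) (C e)) has_sum s) E"
      using hs_cinner_has_sum[OF BV C] E by metis
    moreover have "cinner ((B o\<^sub>L adj_op V) e) (C e) = cinner e (V ((adj_op B o\<^sub>L C) e))" for e
      using V hs_in[OF B] by (simp add: cinner_adj_left flip: cinner_adj_right)
    ultimately show "(\<lambda>e. cinner e (V ((adj_op B o\<^sub>L C) e))) summable_on E"
      by (auto simp: summable_on_def)
  qed
  obtain s where s: "\<And>E. is_onb E \<Longrightarrow> ((\<lambda>e. cinner (blinfun_apply B e) (C e)) has_sum s) E"
    "\<And>E. is_onb E \<Longrightarrow> ((\<lambda>e. cinner (adj_op C e) (adj_op B e)) has_sum s) E"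
    by (rule hs_cinner_has_sum[OF B C], rule that)
  have "op_trace (adj_op B o\<^sub>L C) = s"
    unfolding op_trace_def using s(1)[OF some_onb] hs_in[OF B] by (simp add: cinner_adj_right infsumI)
  then show "is_onb E \<Longrightarrow> ((\<lambda>e. cinner (blinfun_apply B e) (C e)) has_sum op_trace (adj_op B o\<^sub>L C)) E"
    "is_onb E \<Longrightarrow> ((\<lambda>e. cinner (adj_op C e) (adj_op B e)) has_sum op_trace (adj_op B o\<^sub>L C)) E"
    using s by simp_all
qed

lemma op_trace_has_sum:
  assumes "T \<in> trace_class" "is_onb E"
  shows "((\<lambda>e. cinner e (blinfun_apply T e)) has_sum op_trace T) E"
proof -
  obtain B C where BC: "hilbert_schmidt B" "hilbert_schmidt C" "T = adj_op B o\<^sub>L C"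
    by (rule trace_class_factor[OF assms(1)], rule that)
  show ?thesis using hs_product_trace(2)[OF BC(1,2) assms(2)] hs_in[OF BC(1)]
    by (simp add: BC(3) cinner_adj_right)
qed

lemma op_traceI:
  "T \<in> trace_class \<Longrightarrow> is_onb E \<Longrightarrow> ((\<lambda>e. cinner e (blinfun_apply T e)) has_sum s) E \<Longrightarrow> op_trace T = s"
  using op_trace_has_sum has_sum_unique by blast

lemma op_trace_add:
  assumes "S \<in> trace_class" "T \<in> trace_class"
  shows "op_trace (S + T) = op_trace S + op_trace T"
  by (rule op_traceI[OF trace_class_add[OF assms] some_onb])
     (auto simp: blinfun.add_left cinner_add_right intro!: has_sum_add op_trace_has_sum assms some_onb)

lemma op_trace_scaleC_op:
  assumes "T \<in> trace_class"
  shows "op_trace (c *\<^sub>O T) = c * op_trace T"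
  by (rule op_traceI[OF trace_class_scaleC_op[OF assms] some_onb])
     (auto simp: scaleC_op.rep_eq cinner_scaleC_right intro!: has_sum_cmult_right op_trace_has_sum assms some_onb)

lemma trace_class_compose_right:
  assumes "T \<in> trace_class" "S \<in> bounded_ops"
  shows "T o\<^sub>L S \<in> trace_class"
proof -
  obtain B C where BC: "hilbert_schmidt B" "hilbert_schmidt C" "T = adj_op B o\<^sub>L C"
    by (rule trace_class_factor[OF assms(1)], rule that)
  have "T o\<^sub>L S = adj_op B o\<^sub>L (C o\<^sub>L S)" by (intro blinfun_eqI) (simp add: BC(3))
  then show ?thesis using hs_product_trace(1)[OF BC(1) hs_compose_right[OF BC(2) assms(2)]] by simp
qed

text \<open>
  If \<open>T = B* C\<close> then \<open>T S = B* (C S)\<close> and \<open>S T = (B S*)* C\<close>, and the series that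
  \<open>hs_product_trace(3)\<close> assigns to these two factorisations agree term by term.
\<close>

lemma op_trace_cyclic:
  assumes T: "T \<in> trace_class" and S: "S \<in> bounded_ops"
  shows "op_trace (T o\<^sub>L S) = op_trace (S o\<^sub>L T)"
proof -
  obtain B C where BC: "hilbert_schmidt B" "hilbert_schmidt C" "T = adj_op B o\<^sub>L C"
    by (rule trace_class_factor[OF T], rule that)
  note in_ops = hs_in[OF BC(1)] hs_in[OF BC(2)] S adj_op_in[OF S]
  have CS: "hilbert_schmidt (C o\<^sub>L S)" by (rule hs_compose_right[OF BC(2) S])
  have BS: "hilbert_schmidt (B o\<^sub>L adj_op S)" by (rule hs_compose_right[OF BC(1) adj_op_in[OF S]])
  have "T o\<^sub>L S = adj_op B o\<^sub>L (C o\<^sub>L S)" by (intro blinfun_eqI) (simp add: BC(3))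
  then have 1: "((\<lambda>e. cinner (adj_op (C o\<^sub>L S) e) (adj_op B e)) has_sum op_trace (T o\<^sub>L S)) (SOME E. is_onb E)"
    using hs_product_trace(3)[OF BC(1) CS some_onb] by simp
  have "S o\<^sub>L T = adj_op (B o\<^sub>L adj_op S) o\<^sub>L C"
    using in_ops by (intro blinfun_eqI) (simp add: BC(3) adj_compose)
  then have 2: "((\<lambda>e. cinner (adj_op C e) (adj_op (B o\<^sub>L adj_op S) e)) has_sum op_trace (S o\<^sub>L T)) (SOME E. is_onb E)"
    using hs_product_trace(3)[OF BS BC(2) some_onb] by simp
  have "cinner (adj_op (C o\<^sub>L S) e) (adj_op B e) = cinner (adj_op C e) (adj_op (B o\<^sub>L adj_op S) e)" for e
    using in_ops by (simp add: adj_compose cinner_adj_left)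
  then show ?thesis using 1 2 has_sum_unique by simp
qed

lemma positive_op_trace:
  assumes "positive_op P" "P \<in> trace_class"
  shows "op_trace P = of_real (Re (op_trace P))" "0 \<le> Re (op_trace P)"
proof -
  note s = op_trace_has_sum[OF assms(2) some_onb]
  have "((\<lambda>e. Im (cinner e (P e))) has_sum Im (op_trace P)) (SOME E. is_onb E)"
    by (rule has_sum_Im[OF s])
  then have "Im (op_trace P) = 0"
    unfolding positive_op_Im[OF assms(1)] by (rule has_sum_unique) (rule has_sum_0_simp)
  then show "op_trace P = of_real (Re (op_trace P))" by (simp add: complex_eq_iff)
  show "0 \<le> Re (op_trace P)"
    by (rule has_sum_nonneg[OF has_sum_Re[OF s]]) (rule positive_op_Re[OF assms(1)])
qed

text \<open>
  With \<open>P = D o D\<close>, cyclicity distributes \<open>D\<close> to both sides of \<open>S\<close>: the trace of \<open>P o S\<close> is the sum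
  of \<open>cinner (D e) (S (D e))\<close>, and that of \<open>P\<close> is the sum of \<open>norm (D e) ^ 2\<close>.
\<close>

lemma op_trace_positive_bound:
  assumes P: "positive_op P" "P \<in> trace_class" and S: "S \<in> bounded_ops"
  shows "cmod (op_trace (P o\<^sub>L S)) \<le> norm S * Re (op_trace P)"
proof -
  define E :: "'a set" where "E = (SOME E. is_onb E)"
  have E: "is_onb E" unfolding E_def by (rule some_onb)
  obtain D where D: "positive_op D" "D o\<^sub>L D = P" "hilbert_schmidt D"
    using positive_op_hs_root[OF P(1) E] op_trace_has_sum[OF P(2) E] summable_on_def by metis
  have DS: "hilbert_schmidt (D o\<^sub>L S)" by (rule hs_compose_right[OF D(3) S])
  have "P o\<^sub>L S = adj_op D o\<^sub>L (D o\<^sub>L S)"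
    by (intro blinfun_eqI) (simp add: positive_op_adj D flip: D(2))
  then have "((\<lambda>e. cinner (adj_op (D o\<^sub>L S) e) (adj_op D e)) has_sum op_trace (P o\<^sub>L S)) E"
    using hs_product_trace(3)[OF D(3) DS E] by simp
  moreover have "cinner (adj_op (D o\<^sub>L S) e) (adj_op D e) = cinner (D e) (S (D e))" for e
    using S hs_in[OF D(3)] by (simp add: adj_compose cinner_adj_left positive_op_adj[OF D(1)])
  ultimately have 1: "((\<lambda>e. cinner (D e) (S (D e))) has_sum op_trace (P o\<^sub>L S)) E" by simp
  have "Re (cinner e (P e)) = (norm (D e))\<^sup>2" for e
    using positive_op_selfadjoint[OF D(1), of e "D e"] D(2) by (auto simp: norm_sq_eq)
  then have 2: "((\<lambda>e. norm S * (norm (D e))\<^sup>2) has_sum (norm S * Re (op_trace P))) E"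
    using has_sum_cmult_right[OF has_sum_Re[OF op_trace_has_sum[OF P(2) E]], of "norm S"] by simp
  show ?thesis
  proof (rule norm_infsum_le[OF 1 2])
    fix e
    have "cmod (cinner (D e) (S (D e))) \<le> norm (D e) * (norm S * norm (D e))"
      by (rule order_trans[OF cauchy_schwarz mult_left_mono[OF norm_blinfun]]) simp
    then show "cmod (cinner (D e) (S (D e))) \<le> norm S * (norm (D e))\<^sup>2"
      by (simp add: power2_eq_square mult_ac)
  qed
qed

text \<open>Every product \<open>adj_op B o C\<close> is a combination of four operators \<open>adj_op N o N\<close>.\<close>

lemma trace_class_induct [consumes 1, case_names positive add scaleC]:
  assumes "T \<in> trace_class"
    and pos: "\<And>P. positive_op P \<Longrightarrow> P \<in> trace_class \<Longrightarrow> Q P"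
    and add: "\<And>S T. S \<in> trace_class \<Longrightarrow> T \<in> trace_class \<Longrightarrow> Q S \<Longrightarrow> Q T \<Longrightarrow> Q (S + T)"
    and scale: "\<And>c T. T \<in> trace_class \<Longrightarrow> Q T \<Longrightarrow> Q (c *\<^sub>O T)"
  shows "Q T"
proof -
  obtain B C where BC: "hilbert_schmidt B" "hilbert_schmidt C" "T = adj_op B o\<^sub>L C"
    by (rule trace_class_factor[OF assms(1)], rule that)
  define N where "N c = adj_op (B + c *\<^sub>O C) o\<^sub>L (B + c *\<^sub>O C)" for c
  note in_ops = hs_in[OF BC(1)] hs_in[OF BC(2)]
  have N: "N c \<in> trace_class" "Q (N c)" for c
  proof -
    show tc: "N c \<in> trace_class"
      unfolding N_def by (intro hs_product_trace(1) hs_add hs_scaleC_op BC)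
    show "Q (N c)"
      using tc unfolding N_def by (intro pos positive_op_adj_compose) (auto intro!: in_ops)
  qed
  have bop: "B + c *\<^sub>O C \<in> bounded_ops" for c using in_ops by blast
  have "T = (1/4) *\<^sub>O (N 1 + ((-1) *\<^sub>O N (-1) + ((-\<i>) *\<^sub>O N \<i> + \<i> *\<^sub>O N (-\<i>))))"
    unfolding BC(3) N_def
    by (intro bounded_ops_eqI)
       (simp add: blinfun.add_left scaleC_op.rep_eq cinner_simps cinner_adj_right bop in_ops algebra_simps)
  moreover have "Q \<dots>"
    by (intro scale add N trace_class_add trace_class_scaleC_op)
  ultimately show ?thesis by simp
qed

lemma bounded_linear_rank_one: "bounded_linear (\<lambda>z. cinner x z *\<^sub>C (y :: 'a::complex_hilbert))"
proof (rule bounded_linear_intro[where K = "norm x * norm y"])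
  show "norm (cinner x z *\<^sub>C y) \<le> norm z * (norm x * norm y)" for z
    using mult_right_mono[OF cauchy_schwarz[of x z], of "norm y"] by (simp add: norm_scaleC mult_ac)
  show "cinner x (r *\<^sub>R z) *\<^sub>C y = r *\<^sub>R (cinner x z *\<^sub>C y)" for r z
    by (simp add: cinner_scaleC_right scaleC_scaleC flip: scaleC_of_real)
qed (simp add: cinner_add_right scaleC_add_left)

text \<open>The rank-one operator $|y\rangle\langle x|$.\<close>

lift_definition rank_one :: "'a::complex_hilbert \<Rightarrow> 'a \<Rightarrow> ('a \<Rightarrow>\<^sub>L 'a)"
  is "\<lambda>y x z. cinner x z *\<^sub>C y"
  by (rule bounded_linear_rank_one)

lemma rank_one_in: "rank_one y x \<in> bounded_ops"
  by (simp add: bounded_ops_def rank_one.rep_eq cinner_scaleC_right scaleC_scaleC)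

lemma rank_one_trace_class: "rank_one y x \<in> trace_class"
  unfolding trace_class_iff
proof (intro conjI rank_one_in ballI allI impI)
  fix V :: "'a \<Rightarrow>\<^sub>L 'a" and E :: "'a set" assume V: "V \<in> bounded_ops" and E: "is_onb E"
  have "((\<lambda>e. cinner x e * cinner e (V y)) has_sum cinner x (V y)) E" by (rule parseval_cinner[OF E])
  then show "(\<lambda>e. cinner e (V (rank_one y x e))) summable_on E"
    by (auto simp: rank_one.rep_eq bounded_ops_scaleC[OF V] cinner_scaleC_right summable_on_def)
qed

lemma op_trace_rank_one: "op_trace (rank_one y x) = cinner x y"
  by (rule op_traceI[OF rank_one_trace_class some_onb])
     (use parseval_cinner[OF some_onb, of x y] in \<open>simp add: rank_one.rep_eq cinner_scaleC_right\<close>)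

lemma compose_rank_one: "S \<in> bounded_ops \<Longrightarrow> S o\<^sub>L rank_one y x = rank_one (S y) x"
  by (intro blinfun_eqI) (simp add: rank_one.rep_eq bounded_ops_scaleC)

lemma op_trace_rank_one_compose:
  assumes "S \<in> bounded_ops"
  shows "op_trace (rank_one y x o\<^sub>L S) = cinner x (blinfun_apply S y)"
  by (simp add: op_trace_cyclic[OF rank_one_trace_class assms] compose_rank_one[OF assms] op_trace_rank_one)

lemma positive_rank_one: "positive_op (rank_one x x)"
  unfolding positive_op_def
proof (intro conjI rank_one_in allI)
  fix z
  have "cinner z (rank_one x x z) = of_real ((cmod (cinner x z))\<^sup>2)"
    unfolding rank_one.rep_eq cinner_scaleC_right complex_norm_square by simp
  then show "cinner z (rank_one x x z) \<in> \<real>\<^sub>\<ge>\<^sub>0" by (simp add: complex_nonneg_Reals_iff)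
qed


section \<open>The dual of a quantum operation\<close>

lemma qo_trace_class: "quantum_operation \<Psi> \<Longrightarrow> T \<in> trace_class \<Longrightarrow> \<Psi> T \<in> trace_class"
  by (simp add: quantum_operation_def)

lemma qo_add:
  "quantum_operation \<Psi> \<Longrightarrow> S \<in> trace_class \<Longrightarrow> T \<in> trace_class \<Longrightarrow> \<Psi> (S + T) = \<Psi> S + \<Psi> T"
  by (simp add: quantum_operation_def)

lemma qo_scaleC: "quantum_operation \<Psi> \<Longrightarrow> T \<in> trace_class \<Longrightarrow> \<Psi> (c *\<^sub>O T) = c *\<^sub>O \<Psi> T"
  by (simp add: quantum_operation_def)

lemma qo_op_trace: "quantum_operation \<Psi> \<Longrightarrow> T \<in> trace_class \<Longrightarrow> op_trace (\<Psi> T) = op_trace T"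
  by (simp add: quantum_operation_def)

lemma qo_positive_op_matrix:
  "quantum_operation \<Psi> \<Longrightarrow> (\<And>i j. T i j \<in> trace_class) \<Longrightarrow> positive_op_matrix n T \<Longrightarrow>
     positive_op_matrix n (\<lambda>i j. \<Psi> (T i j))"
  by (simp add: quantum_operation_def completely_positive_def)

lemma qo_positive:
  assumes "quantum_operation \<Psi>" "positive_op P" "P \<in> trace_class"
  shows "positive_op (\<Psi> P)"
proof -
  have "positive_op_matrix 1 (\<lambda>i j. P)"
    using assms(2) by (simp add: positive_op_matrix_def positive_op_def)
  then have "positive_op_matrix 1 (\<lambda>i j. \<Psi> P)"
    by (rule qo_positive_op_matrix[OF assms(1) assms(3)])
  then have "cinner (x 0) (\<Psi> P (x 0)) \<in> \<real>\<^sub>\<ge>\<^sub>0" for x :: "nat \<Rightarrow> 'a"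
    by (simp add: positive_op_matrix_def)
  from this[of "\<lambda>_. z" for z] show ?thesis
    using trace_class_in[OF qo_trace_class[OF assms(1,3)]] by (simp add: positive_op_def)
qed

lemma compose_add_left: "(S + T) o\<^sub>L X = (S o\<^sub>L X) + (T o\<^sub>L X)"
  by (intro blinfun_eqI) (simp add: blinfun.add_left)

lemma compose_scaleC_left: "(c *\<^sub>O T) o\<^sub>L X = c *\<^sub>O (T o\<^sub>L X)"
  by (intro blinfun_eqI) (simp add: scaleC_op.rep_eq)

lemma op_trace_compose_add:
  assumes "S \<in> trace_class" "T \<in> trace_class" "X \<in> bounded_ops"
  shows "op_trace ((S + T) o\<^sub>L X) = op_trace (S o\<^sub>L X) + op_trace (T o\<^sub>L X)"
  unfolding compose_add_left using assms by (intro op_trace_add trace_class_compose_right)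

lemma op_trace_compose_scaleC:
  assumes "T \<in> trace_class" "X \<in> bounded_ops"
  shows "op_trace ((c *\<^sub>O T) o\<^sub>L X) = c * op_trace (T o\<^sub>L X)"
  unfolding compose_scaleC_left using assms by (intro op_trace_scaleC_op trace_class_compose_right)

lemma rank_one_add_left: "rank_one (y + y') x = rank_one y x + rank_one y' x"
  by (intro blinfun_eqI) (simp add: rank_one.rep_eq blinfun.add_left scaleC_add_right)

lemma rank_one_add_right: "rank_one y (x + x') = rank_one y x + rank_one y x'"
  by (intro blinfun_eqI) (simp add: rank_one.rep_eq blinfun.add_left scaleC_add_left cinner_add_left)

lemma rank_one_scaleC_left: "rank_one (c *\<^sub>C y) x = c *\<^sub>O rank_one y x"
  by (intro blinfun_eqI) (simp add: rank_one.rep_eq scaleC_op.rep_eq scaleC_scaleC mult.commute)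

lemma rank_one_scaleC_right: "rank_one y (c *\<^sub>C x) = cnj c *\<^sub>O rank_one y x"
  by (intro blinfun_eqI) (simp add: rank_one.rep_eq scaleC_op.rep_eq scaleC_scaleC cinner_scaleC_left)

lemma qo_op_trace_positive_bound:
  assumes "quantum_operation \<Psi>" "positive_op P" "P \<in> trace_class" "S \<in> bounded_ops"
  shows "cmod (op_trace (\<Psi> P o\<^sub>L S)) \<le> norm S * Re (op_trace P)"
  using op_trace_positive_bound[OF qo_positive[OF assms(1-3)] qo_trace_class[OF assms(1,3)] assms(4)]
  by (simp add: qo_op_trace assms)

text \<open>
  Positivity and trace preservation control \<open>\<Psi>\<close> on the operators \<open>rank_one u u\<close>; polarisation
  carries this over to unit vectors \<open>x\<close> and \<open>y\<close>, and homogeneity to all vectors.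
\<close>

lemma qo_rank_one_bound:
  assumes qo: "quantum_operation \<Psi>" and S: "S \<in> bounded_ops"
  shows "cmod (op_trace (\<Psi> (rank_one y x) o\<^sub>L S)) \<le> 4 * norm S * norm x * norm y"
proof -
  define b where "b x y = op_trace (\<Psi> (rank_one y x) o\<^sub>L S)" for x y
  note tc = rank_one_trace_class
  have b_add_right: "b x (y + y') = b x y + b x y'" for x y y'
    by (simp add: b_def rank_one_add_left qo_add[OF qo tc tc] op_trace_compose_add qo_trace_class[OF qo tc] S)
  have b_add_left: "b (x + x') y = b x y + b x' y" for x x' y
    by (simp add: b_def rank_one_add_right qo_add[OF qo tc tc] op_trace_compose_add qo_trace_class[OF qo tc] S)
  have b_sc_right: "b x (c *\<^sub>C y) = c * b x y" for c x y
    by (simp add: b_def rank_one_scaleC_left qo_scaleC[OF qo tc] op_trace_compose_scaleC qo_trace_class[OF qo tc] S)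
  have b_sc_left: "b (c *\<^sub>C x) y = cnj c * b x y" for c x y
    by (simp add: b_def rank_one_scaleC_right qo_scaleC[OF qo tc] op_trace_compose_scaleC qo_trace_class[OF qo tc] S)
  have diag: "cmod (b u u) \<le> norm S * (norm u)\<^sup>2" for u
    using qo_op_trace_positive_bound[OF qo positive_rank_one[of u] tc S]
    by (simp add: b_def op_trace_rank_one cinner_self)
  have unit: "cmod (b u v) \<le> 4 * norm S" if "norm u = 1" "norm v = 1" for u v
  proof -
    have pol: "4 * b u v = (b (u + v) (u + v) + (-1) * b (u + (-1) *\<^sub>C v) (u + (-1) *\<^sub>C v))
        + ((-\<i>) * b (u + \<i> *\<^sub>C v) (u + \<i> *\<^sub>C v) + \<i> * b (u + (-\<i>) *\<^sub>C v) (u + (-\<i>) *\<^sub>C v))"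
      by (simp add: b_add_left b_add_right b_sc_left b_sc_right algebra_simps)
    have tm: "cmod (w * b (u + c *\<^sub>C v) (u + c *\<^sub>C v)) \<le> 4 * norm S" if "cmod w = 1" "cmod c = 1" for w c
    proof -
      have "norm (u + c *\<^sub>C v) \<le> 2"
        using norm_triangle_ineq[of u "c *\<^sub>C v"] \<open>norm u = 1\<close> \<open>norm v = 1\<close> that by (simp add: norm_scaleC)
      then have "(norm (u + c *\<^sub>C v))\<^sup>2 \<le> 2\<^sup>2" by (intro power_mono) auto
      then have "norm S * (norm (u + c *\<^sub>C v))\<^sup>2 \<le> norm S * 4" by (intro mult_left_mono) auto
      then show ?thesis using diag[of "u + c *\<^sub>C v"] that by (simp add: norm_mult)
    qed
    have "cmod (4 * b u v) \<le> (4 * norm S + 4 * norm S) + (4 * norm S + 4 * norm S)"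
      unfolding pol
      using tm[of 1 1] tm[of "-1" "-1"] tm[of "-\<i>" \<i>] tm[of \<i> "-\<i>"]
      by (intro order_trans[OF norm_triangle_ineq] add_mono) simp_all
    then show ?thesis by (simp add: norm_mult)
  qed
  show ?thesis
  proof (cases "x = 0 \<or> y = 0")
    case True
    have "b 0 y = 0" "b x 0 = 0" using b_sc_left[of 0 0 y] b_sc_right[of x 0 0] by simp_all
    then have "b x y = 0" using True by auto
    then show ?thesis by (simp add: b_def)
  next
    case False
    define u where "u = of_real (inverse (norm x)) *\<^sub>C x"
    define v where "v = of_real (inverse (norm y)) *\<^sub>C y"
    have "norm u = 1" "norm v = 1" using False by (simp_all add: u_def v_def norm_scaleC norm_inverse)
    then have "cmod (b u v) \<le> 4 * norm S" by (rule unit)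
    moreover have "b x y = of_real (norm x) * (of_real (norm y) * b u v)"
      using False by (simp add: u_def v_def b_sc_left b_sc_right field_simps)
    ultimately have "cmod (b x y) \<le> norm x * (norm y * (4 * norm S))"
      by (simp add: norm_mult mult_left_mono)
    then show ?thesis by (simp add: b_def mult_ac)
  qed
qed

lemma qo_dual_rank_one:
  assumes qo: "quantum_operation \<Psi>" and S: "S \<in> bounded_ops"
  obtains X where "X \<in> bounded_ops"
    "\<And>x y. op_trace (\<Psi> (rank_one y x) o\<^sub>L S) = cinner x (blinfun_apply X y)"
proof -
  note tc = rank_one_trace_class
  obtain W where W: "W \<in> bounded_ops"
    "\<And>x y. cinner (blinfun_apply W x) y = op_trace (\<Psi> (rank_one y x) o\<^sub>L S)"
  proof (rule sesquilinear_operator[OF csubspace_UNIV, of "4 * norm S"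
        "\<lambda>x y. op_trace (\<Psi> (rank_one y x) o\<^sub>L S)"])
    show "cmod (op_trace (\<Psi> (rank_one m y) o\<^sub>L S)) \<le> 4 * norm S * norm y * norm m" for y m
      by (rule qo_rank_one_bound[OF qo S])
  qed (simp_all add: rank_one_add_left rank_one_add_right rank_one_scaleC_left rank_one_scaleC_right
      qo_add[OF qo tc tc] qo_scaleC[OF qo tc] op_trace_compose_add op_trace_compose_scaleC
      qo_trace_class[OF qo tc] S)
  show ?thesis
    by (rule that[of "adj_op W"]) (use W in \<open>auto simp: cinner_adj_right\<close>)
qed

lemma trace_class_sum: "(\<And>i. i \<in> I \<Longrightarrow> T i \<in> trace_class) \<Longrightarrow> (\<Sum>i\<in>I. T i) \<in> trace_class"
  by (induction I rule: infinite_finite_induct) (auto intro: trace_class_add trace_class_zero)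

text \<open>
  The duality relation passes from rank-one to positive operators by monotone approximation: with
  \<open>P = D o D\<close>, the rest of \<open>P\<close> beyond a finite part of the expansion of \<open>D x\<close> in \<open>E\<close> is positive with
  small trace, and both sides are bounded by the trace on positive operators.
\<close>

lemma qo_dual_exists:
  assumes qo: "quantum_operation \<Psi>" and S: "S \<in> bounded_ops"
  obtains X where "X \<in> bounded_ops"
    "\<And>T. T \<in> trace_class \<Longrightarrow> op_trace (\<Psi> T o\<^sub>L S) = op_trace (T o\<^sub>L X)"
proof -
  obtain X where X: "X \<in> bounded_ops"
    "\<And>x y. op_trace (\<Psi> (rank_one y x) o\<^sub>L S) = cinner x (blinfun_apply X y)"
    by (rule qo_dual_rank_one[OF qo S], rule that)
  define d where "d T = op_trace (\<Psi> T o\<^sub>L S) - op_trace (T o\<^sub>L X)" for T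
  have d_add: "d (T + T') = d T + d T'" if "T \<in> trace_class" "T' \<in> trace_class" for T T'
    using that by (simp add: d_def qo_add[OF qo] op_trace_compose_add qo_trace_class[OF qo] S X(1))
  have d_sc: "d (c *\<^sub>O T) = c * d T" if "T \<in> trace_class" for c T
    using that by (simp add: d_def qo_scaleC[OF qo] op_trace_compose_scaleC qo_trace_class[OF qo] S X(1)
        algebra_simps)
  have d_rank_one: "d (rank_one y x) = 0" for x y
    by (simp add: d_def X op_trace_rank_one_compose)
  have d_pos: "d P = 0" if P: "positive_op P" "P \<in> trace_class" for P
  proof -
    define E :: "'a set" where "E = (SOME E. is_onb E)"
    have E: "is_onb E" unfolding E_def by (rule some_onb)
    note tr = op_trace_has_sum[OF P(2) E]
    obtain D where D: "positive_op D" "D o\<^sub>L D = P"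
      by (rule positive_sqrt[OF P(1)], rule that)
    have DP: "cinner x (P x) = of_real ((norm (D x))\<^sup>2)" for x
      using positive_op_selfadjoint[OF D(1), of x "D x"] D(2) by (auto simp: cinner_self)
    \<comment> \<open>bounds \<open>d\<close> by the trace on positive operators; the summand \<open>1\<close> only makes it nonzero\<close>
    define K where "K = norm S + norm X + 1"
    have K: "K > 0" by (simp add: K_def add_nonneg_pos)
    have bd: "(\<Sum>e\<in>F. Re (cinner e (P e))) \<le> Re (op_trace P) - cmod (d P) / K"
      if F: "finite F" "F \<subseteq> E" for F
    proof -
      define PF where "PF = (\<Sum>e\<in>F. rank_one (D e) (D e))"
      define R where "R = P + (-1) *\<^sub>O PF"
      have PF: "PF \<in> trace_class" unfolding PF_def by (intro trace_class_sum rank_one_trace_class)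
      have mPF: "(-1) *\<^sub>O PF \<in> trace_class" by (rule trace_class_scaleC_op[OF PF])
      have R: "R \<in> trace_class" unfolding R_def by (intro trace_class_add P mPF)
      have PF_ap: "cinner x (PF x) = of_real (\<Sum>e\<in>F. (cmod (cinner e (D x)))\<^sup>2)" for x
      proof -
        have "cinner x (rank_one (D e) (D e) x) = of_real ((cmod (cinner e (D x)))\<^sup>2)" for e
        proof -
          have "cinner (D e) x = cinner e (D x)" by (rule positive_op_selfadjoint[OF D(1)])
          moreover from this have "cinner x (D e) = cnj (cinner e (D x))" by (metis cnj_cinner)
          ultimately show ?thesis
            unfolding rank_one.rep_eq cinner_scaleC_right complex_norm_square by simp
        qed
        then show ?thesis by (simp add: PF_def blinfun.sum_left cinner.sum_right)
      qed
      have Rpos: "positive_op R"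
        unfolding positive_op_def complex_nonneg_Reals_iff
      proof (intro conjI allI)
        show "R \<in> bounded_ops" by (rule trace_class_in[OF R])
        fix x
        have "cinner x (R x) = of_real ((norm (D x))\<^sup>2 - (\<Sum>e\<in>F. (cmod (cinner e (D x)))\<^sup>2))"
          by (simp add: R_def blinfun.add_left scaleC_op.rep_eq cinner_simps DP PF_ap)
        then show "0 \<le> Re (cinner x (R x))" "Im (cinner x (R x)) = 0"
          using bessel[OF is_onb_orthonormal[OF E] F, of "D x"] by simp_all
      qed
      have PF_lin: "op_trace PF = (\<Sum>e\<in>F. cinner e (P e)) \<and> d PF = 0"
        unfolding PF_def using F(1)
      proof (induction F)
        case empty
        have "0 *\<^sub>O 0 = (0 :: 'a \<Rightarrow>\<^sub>L 'a)"
          by (intro blinfun_eqI) (simp add: scaleC_op.rep_eq)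
        then show ?case using d_sc[OF trace_class_zero, of 0] by (simp add: op_trace_def)
      next
        case (insert e F)
        have "(\<Sum>e\<in>F. rank_one (D e) (D e)) \<in> trace_class"
          by (intro trace_class_sum rank_one_trace_class)
        then show ?case
          using insert by (simp add: op_trace_add[OF rank_one_trace_class] d_add[OF rank_one_trace_class]
              d_rank_one op_trace_rank_one DP cinner_self)
      qed
      have dR: "d R = d P"
        unfolding R_def using PF_lin by (simp add: d_add P mPF d_sc PF)
      have trR: "Re (op_trace R) = Re (op_trace P) - (\<Sum>e\<in>F. Re (cinner e (P e)))"
        unfolding R_def using PF_lin by (simp add: op_trace_add P mPF op_trace_scaleC_op PF)
      have "cmod (d R) \<le> cmod (op_trace (\<Psi> R o\<^sub>L S)) + cmod (op_trace (R o\<^sub>L X))"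
        unfolding d_def by (rule norm_triangle_ineq4)
      also have "\<dots> \<le> norm S * Re (op_trace R) + norm X * Re (op_trace R)"
        by (intro add_mono qo_op_trace_positive_bound[OF qo Rpos R S] op_trace_positive_bound[OF Rpos R X(1)])
      also have "\<dots> \<le> K * Re (op_trace R)"
        using positive_op_trace(2)[OF Rpos R] by (simp add: K_def algebra_simps)
      finally have "cmod (d P) / K \<le> Re (op_trace R)"
        using K by (simp add: dR pos_divide_le_eq mult.commute)
      then show ?thesis by (simp add: trR)
    qed
    have "Re (op_trace P) \<le> Re (op_trace P) - cmod (d P) / K"
      by (rule has_sum_le_finite_sums[OF has_sum_Re[OF tr] bd])
    then have "cmod (d P) / K \<le> 0" by simp
    then show ?thesis using K by (simp add: divide_le_0_iff)
  qed
  have "d T = 0" if "T \<in> trace_class" for T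
    using that by (induction T rule: trace_class_induct) (simp_all add: d_pos d_add d_sc)
  then show ?thesis using that[OF X(1)] by (simp add: d_def)
qed

lemma trace_separates_bounded:
  assumes "X \<in> bounded_ops" "Y \<in> bounded_ops"
    and "\<And>T. T \<in> trace_class \<Longrightarrow> op_trace (T o\<^sub>L X) = op_trace (T o\<^sub>L Y)"
  shows "X = Y"
  by (rule bounded_ops_eqI)
     (use assms(3)[OF rank_one_trace_class] assms(1,2) in \<open>simp add: op_trace_rank_one_compose\<close>)

lemma trace_separates_trace_class:
  assumes "X \<in> trace_class" "Y \<in> trace_class"
    and "\<And>S. S \<in> bounded_ops \<Longrightarrow> op_trace (X o\<^sub>L S) = op_trace (Y o\<^sub>L S)"
  shows "X = Y"
proof (rule bounded_ops_eqI)
  fix x y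
  note X = trace_class_in[OF assms(1)] and Y = trace_class_in[OF assms(2)]
  have "op_trace (rank_one y x o\<^sub>L X) = op_trace (rank_one y x o\<^sub>L Y)"
    using assms(3)[OF rank_one_in, of y x]
    by (simp add: op_trace_cyclic[OF assms(1) rank_one_in] op_trace_cyclic[OF assms(2) rank_one_in])
  then show "cinner x (X y) = cinner x (Y y)" by (simp add: op_trace_rank_one_compose X Y)
qed

lemma dual_map_ex1:
  assumes "quantum_operation \<Psi>" "S \<in> bounded_ops"
  shows "\<exists>!X. X \<in> bounded_ops \<and> (\<forall>T\<in>trace_class. op_trace (\<Psi> T o\<^sub>L S) = op_trace (T o\<^sub>L X))"
proof -
  obtain X where "X \<in> bounded_ops"
    "\<And>T. T \<in> trace_class \<Longrightarrow> op_trace (\<Psi> T o\<^sub>L S) = op_trace (T o\<^sub>L X)"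
    by (rule qo_dual_exists[OF assms], rule that)
  then show ?thesis
    by (intro ex1I[of _ X]) (auto intro!: trace_separates_bounded)
qed

lemma dual_map_in: "quantum_operation \<Psi> \<Longrightarrow> S \<in> bounded_ops \<Longrightarrow> dual_map \<Psi> S \<in> bounded_ops"
  using theI'[OF dual_map_ex1, of \<Psi> S] unfolding dual_map_def by blast

lemma op_trace_dual_map:
  "quantum_operation \<Psi> \<Longrightarrow> S \<in> bounded_ops \<Longrightarrow> T \<in> trace_class \<Longrightarrow>
     op_trace (\<Psi> T o\<^sub>L S) = op_trace (T o\<^sub>L dual_map \<Psi> S)"
  using theI'[OF dual_map_ex1, of \<Psi> S] unfolding dual_map_def by blast

lemma dual_mapI:
  assumes "quantum_operation \<Psi>" "S \<in> bounded_ops" "X \<in> bounded_ops"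
    "\<And>T. T \<in> trace_class \<Longrightarrow> op_trace (\<Psi> T o\<^sub>L S) = op_trace (T o\<^sub>L X)"
  shows "dual_map \<Psi> S = X"
  by (rule trace_separates_bounded) (use assms dual_map_in op_trace_dual_map in fastforce)+

lemma dual_map_id:
  assumes "quantum_operation \<Psi>"
  shows "dual_map \<Psi> id_blinfun = id_blinfun"
proof (rule dual_mapI[OF assms])
  have "T o\<^sub>L id_blinfun = T" for T :: "'a \<Rightarrow>\<^sub>L 'a" by (intro blinfun_eqI) simp
  then show "op_trace (\<Psi> T o\<^sub>L id_blinfun) = op_trace (T o\<^sub>L id_blinfun)" if "T \<in> trace_class" for T
    using qo_op_trace[OF assms that] by simp
qed auto

lemma cinner_dual_map:
  assumes "quantum_operation \<Psi>" "S \<in> bounded_ops"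
  shows "cinner x (dual_map \<Psi> S y) = op_trace (\<Psi> (rank_one y x) o\<^sub>L S)"
  by (simp add: op_trace_dual_map[OF assms rank_one_trace_class] op_trace_rank_one_compose dual_map_in[OF assms])

text \<open>
  Complete positivity of the dual in kernel form.  Moving \<open>X j\<close> around the trace turns the
  sum into a series of values of the form that the amplification of \<open>\<Psi>\<close> assigns to the
  positive matrix \<open>rank_one (x i) (x j)\<close>, evaluated at the vectors \<open>adj_op (X i) e\<close>.
\<close>

lemma dual_map_kernel_nonneg:
  fixes X :: "nat \<Rightarrow> 'a::complex_hilbert \<Rightarrow>\<^sub>L 'a" and n :: nat
  assumes qo: "quantum_operation \<Psi>" and X: "\<And>i. X i \<in> bounded_ops"
  shows "(\<Sum>i<n. \<Sum>j<n. cinner (x i) (dual_map \<Psi> (adj_op (X i) o\<^sub>L X j) (x j))) \<in> \<real>\<^sub>\<ge>\<^sub>0"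
proof -
  define R where "R j i = \<Psi> (rank_one (x j) (x i))" for i j
  have R: "R j i \<in> trace_class" for i j
    unfolding R_def by (intro qo_trace_class[OF qo] rank_one_trace_class)
  define E :: "'a set" where "E = (SOME E. is_onb E)"
  have E: "is_onb E" unfolding E_def by (rule some_onb)
  have pos: "positive_op_matrix n (\<lambda>j i. R j i)"
  proof -
    have "positive_op_matrix n (\<lambda>j i. rank_one (x j) (x i))"
      unfolding positive_op_matrix_def
    proof
      fix z :: "nat \<Rightarrow> 'a"
      define w where "w = (\<Sum>i<n. cinner (x i) (z i))"
      have "(\<Sum>j<n. \<Sum>i<n. cinner (z j) (rank_one (x j) (x i) (z i))) = cnj w * w"
        unfolding w_def cnj_sum sum_product
        by (simp add: rank_one.rep_eq cinner_scaleC_right mult.commute)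
      also have "\<dots> = of_real ((cmod w)\<^sup>2)" by (simp only: complex_norm_square mult.commute)
      finally show "(\<Sum>j<n. \<Sum>i<n. cinner (z j) (rank_one (x j) (x i) (z i))) \<in> \<real>\<^sub>\<ge>\<^sub>0"
        by (simp add: complex_nonneg_Reals_iff)
    qed
    then show ?thesis
      unfolding R_def by (rule qo_positive_op_matrix[OF qo rank_one_trace_class])
  qed
  have sm: "((\<lambda>e. cinner (adj_op (X j) e) (R j i (adj_op (X i) e)))
      has_sum cinner (x i) (dual_map \<Psi> (adj_op (X i) o\<^sub>L X j) (x j))) E" for i j
  proof -
    have RX: "R j i o\<^sub>L adj_op (X i) \<in> trace_class"
      by (intro trace_class_compose_right R adj_op_in X)
    have "R j i o\<^sub>L (adj_op (X i) o\<^sub>L X j) = (R j i o\<^sub>L adj_op (X i)) o\<^sub>L X j"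
      by (intro blinfun_eqI) simp
    then have "cinner (x i) (dual_map \<Psi> (adj_op (X i) o\<^sub>L X j) (x j))
        = op_trace (X j o\<^sub>L (R j i o\<^sub>L adj_op (X i)))"
      using X by (simp add: cinner_dual_map[OF qo] bounded_ops_compose adj_op_in op_trace_cyclic[OF RX]
          flip: R_def)
    then show ?thesis
      using op_trace_has_sum[OF trace_class_compose_left[OF RX X[of j]] E] by (simp add: cinner_adj_left X)
  qed
  define s where "s = (\<Sum>j<n. \<Sum>i<n. cinner (x i) (dual_map \<Psi> (adj_op (X i) o\<^sub>L X j) (x j)))"
  have tot: "((\<lambda>e. \<Sum>j<n. \<Sum>i<n. cinner (adj_op (X j) e) (R j i (adj_op (X i) e))) has_sum s) E"
    unfolding s_def by (intro has_sum_finite_sum sm)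
  have nn: "(\<Sum>j<n. \<Sum>i<n. cinner (adj_op (X j) e) (R j i (adj_op (X i) e))) \<in> \<real>\<^sub>\<ge>\<^sub>0" for e
    using pos unfolding positive_op_matrix_def by (rule allE[of _ "\<lambda>i. adj_op (X i) e"])
  have "0 \<le> Re s"
    by (rule has_sum_nonneg[OF has_sum_Re[OF tot]]) (use nn in \<open>simp add: complex_nonneg_Reals_iff\<close>)
  moreover have "Im s = 0"
  proof -
    have "((\<lambda>e. 0) has_sum Im s) E"
      using has_sum_Im[OF tot] nn by (simp add: complex_nonneg_Reals_iff)
    then show ?thesis by (rule has_sum_unique) (rule has_sum_0_simp)
  qed
  moreover have "(\<Sum>i<n. \<Sum>j<n. cinner (x i) (dual_map \<Psi> (adj_op (X i) o\<^sub>L X j) (x j))) = s"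
    unfolding s_def by (rule sum.swap)
  ultimately show ?thesis by (simp add: complex_nonneg_Reals_iff)
qed

text \<open>
  A positive semidefinite complex form is Hermitian; here it is the kernel for the pair of operators
  \<open>1\<close> and \<open>A\<close>.
\<close>

lemma dual_map_adj:
  assumes qo: "quantum_operation \<Psi>" and A: "A \<in> bounded_ops"
  shows "dual_map \<Psi> (adj_op A) = adj_op (dual_map \<Psi> A)"
proof (rule bounded_ops_eqI)
  fix x y
  define X where "X i = (if i = 0 then id_blinfun else A)" for i :: nat
  have X: "X i \<in> bounded_ops" for i using A by (auto simp: X_def)
  note D = dual_map_in[OF qo]
  have id_left: "id_blinfun o\<^sub>L A = A" and id_right: "adj_op A o\<^sub>L id_blinfun = adj_op A"
    and id_id: "id_blinfun o\<^sub>L id_blinfun = (id_blinfun :: 'a \<Rightarrow>\<^sub>L 'a)"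
    by (intro blinfun_eqI, simp)+
  define q where "q u v = cinner u (dual_map \<Psi> id_blinfun u) + cinner u (dual_map \<Psi> A v)
      + (cinner v (dual_map \<Psi> (adj_op A) u) + cinner v (dual_map \<Psi> (adj_op A o\<^sub>L A) v))" for u v
  have q: "Im (q u v) = 0" for u v
    using dual_map_kernel_nonneg[OF qo, where X = X and n = 2 and x = "\<lambda>i. if i = 0 then u else v", OF X]
    by (simp add: numeral_2_eq_2 X_def id_left id_right id_id q_def complex_nonneg_Reals_iff)
  have "Im (cinner y (dual_map \<Psi> A x) + cinner x (dual_map \<Psi> (adj_op A) y)) = 0"
    using q[of y x] q[of y 0] q[of 0 x] by (simp add: q_def)
  moreover have "Im (\<i> * cinner y (dual_map \<Psi> A x) - \<i> * cinner x (dual_map \<Psi> (adj_op A) y)) = 0"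
    using q[of y "\<i> *\<^sub>C x"] q[of y 0] q[of 0 "\<i> *\<^sub>C x"]
    by (simp add: q_def cinner_simps bounded_ops_scaleC[OF D[OF A]] )
  ultimately have "cinner x (dual_map \<Psi> (adj_op A) y) = cnj (cinner y (dual_map \<Psi> A x))"
    by (simp add: complex_eq_iff del: cnj_cinner)
  then show "cinner x (dual_map \<Psi> (adj_op A) y) = cinner x (adj_op (dual_map \<Psi> A) y)"
    by (simp add: cinner_adj_right D A)
qed

section \<open>The multiplicative domain argument\<close>

lemma complex_linear_term_zero:
  fixes a m :: complex
  assumes nn: "\<And>t::real. of_real t * a + of_real (t\<^sup>2) * m \<in> \<real>\<^sub>\<ge>\<^sub>0"
  shows "a = 0"
proof (rule complex_eqI)
  have "0 \<le> t * Re a + t\<^sup>2 * Re m" for t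
    using nn[of t] by (simp add: complex_nonneg_Reals_iff)
  then show "Re a = Re 0" using linear_term_zero by auto
  show "Im a = Im 0"
    using nn[of 1] nn[of "-1"] by (simp add: complex_nonneg_Reals_iff)
qed

text \<open>
  Moving from \<open>c\<close> by \<open>t\<close> in the \<open>k\<close>-th coordinate changes the form by
  \<open>cnj t * g + t * h + cnj t * t * M k k\<close>, where \<open>g\<close> is the sum in question.  This stays nonnegative,
  so real \<open>t\<close> give \<open>g + h = 0\<close> and imaginary \<open>t\<close> give \<open>h = g\<close>.
\<close>

lemma psd_null_vector:
  fixes M :: "nat \<Rightarrow> nat \<Rightarrow> complex"
  assumes psd: "\<And>c. (\<Sum>i<n. \<Sum>j<n. cnj (c i) * c j * M i j) \<in> \<real>\<^sub>\<ge>\<^sub>0"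
    and null: "(\<Sum>i<n. \<Sum>j<n. cnj (c i) * c j * M i j) = 0" and k: "k < n"
  shows "(\<Sum>j<n. M k j * c j) = 0"
proof -
  define g where "g = (\<Sum>j<n. M k j * c j)"
  define h where "h = (\<Sum>i<n. cnj (c i) * M i k)"
  have F: "cnj t * g + t * h + cnj t * t * M k k \<in> \<real>\<^sub>\<ge>\<^sub>0" for t
  proof -
    define \<delta> where "\<delta> i = (if i = k then t else 0)" for i
    have inner: "(\<Sum>j<n. \<delta> j * f j) = t * f k" for f :: "nat \<Rightarrow> complex"
      using k by (simp add: \<delta>_def if_distrib[of "\<lambda>u. u * _"] cong: if_cong)
    have outer: "(\<Sum>i<n. cnj (\<delta> i) * f i) = cnj t * f k" for f :: "nat \<Rightarrow> complex"
      using k by (simp add: \<delta>_def if_distrib[of cnj] if_distrib[of "\<lambda>u. u * _"] cong: if_cong)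
    have "(\<Sum>i<n. \<Sum>j<n. cnj (c i + \<delta> i) * (c j + \<delta> j) * M i j)
       = (\<Sum>i<n. \<Sum>j<n. cnj (c i) * c j * M i j)
         + (\<Sum>i<n. cnj (\<delta> i) * (\<Sum>j<n. M i j * c j))
         + (\<Sum>i<n. cnj (c i) * (\<Sum>j<n. \<delta> j * M i j))
         + (\<Sum>i<n. cnj (\<delta> i) * (\<Sum>j<n. \<delta> j * M i j))"
      by (simp add: sum_distrib_left sum.distrib[symmetric] algebra_simps)
    also have "\<dots> = cnj t * g + t * h + cnj t * t * M k k"
      unfolding inner outer null unfolding g_def h_def sum_distrib_left by (simp add: mult_ac)
    finally show ?thesis using psd[of "\<lambda>i. c i + \<delta> i"] by simp
  qed
  have "g + h = 0"
    by (rule complex_linear_term_zero[where m = "M k k"])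
       (use F[of "of_real t" for t] in \<open>simp add: power2_eq_square algebra_simps\<close>)
  moreover have "\<i> * (h - g) = 0"
    by (rule complex_linear_term_zero[where m = "M k k"])
       (use F[of "\<i> * of_real t" for t] in \<open>simp add: power2_eq_square algebra_simps\<close>)
  ultimately have "g = 0" by (simp add: eq_iff_diff_eq_0[symmetric] add_eq_0_iff)
  then show ?thesis by (simp add: g_def)
qed

text \<open>
  If \<open>A\<close> and \<open>A A*\<close> are fixed, then for each \<open>y\<close> the formal vector \<open>(y, A*) - (A* y, 1)\<close> is null for
  the kernel of \<open>dual_map_kernel_nonneg\<close>, hence orthogonal to every other vector, in particular to
  \<open>(z, S*)\<close>.
\<close>

lemma dual_map_right_multiplicative:
  assumes qo: "quantum_operation \<Psi>" and A: "A \<in> bounded_ops" and S: "S \<in> bounded_ops"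
    and fixA: "dual_map \<Psi> A = A" and fixAA: "dual_map \<Psi> (A o\<^sub>L adj_op A) = A o\<^sub>L adj_op A"
  shows "dual_map \<Psi> (S o\<^sub>L adj_op A) = dual_map \<Psi> S o\<^sub>L adj_op A"
proof (rule bounded_ops_eqI)
  fix z y
  define x where "x i = (if i = 0 then y else if i = 1 then adj_op A y else z)" for i :: nat
  define X where "X i = (if i = 0 then adj_op A else if i = 1 then id_blinfun else adj_op S)" for i :: nat
  \<comment> \<open>coefficients of the null vector; the third pair \<open>(z, S*)\<close> is only tested against it\<close>
  define c :: "nat \<Rightarrow> complex" where "c i = (if i = 0 then 1 else if i = 1 then -1 else 0)" for i
  define M where "M i j = cinner (x i) (dual_map \<Psi> (adj_op (X i) o\<^sub>L X j) (x j))" for i j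
  have X: "X i \<in> bounded_ops" for i using A S by (auto simp: X_def)
  have D: "dual_map \<Psi> (adj_op (X i) o\<^sub>L X j) \<in> bounded_ops" for i j
    by (intro dual_map_in[OF qo] bounded_ops_compose adj_op_in X)
  have psd: "(\<Sum>i<3. \<Sum>j<3. cnj (u i) * u j * M i j) \<in> \<real>\<^sub>\<ge>\<^sub>0" for u
    using dual_map_kernel_nonneg[OF qo, where X = X and n = 3 and x = "\<lambda>i. u i *\<^sub>C x i", OF X]
    by (simp add: M_def cinner_scaleC_left cinner_scaleC_right bounded_ops_scaleC[OF D] mult_ac)
  have id_right: "T o\<^sub>L id_blinfun = T" and id_left: "id_blinfun o\<^sub>L T = T" for T :: "'a \<Rightarrow>\<^sub>L 'a"
    by (intro blinfun_eqI, simp)+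
  have A': "dual_map \<Psi> (adj_op A) = adj_op A" using dual_map_adj[OF qo A] fixA by simp
  have M: "M 0 0 = cinner (adj_op A y) (adj_op A y)" "M 0 1 = cinner (adj_op A y) (adj_op A y)"
    "M 1 0 = cinner (adj_op A y) (adj_op A y)" "M 1 1 = cinner (adj_op A y) (adj_op A y)"
    using A fixA fixAA A' dual_map_id[OF qo]
    by (simp_all add: M_def x_def X_def id_left id_right cinner_adj_left)
  have M2: "M 2 0 = cinner z (dual_map \<Psi> (S o\<^sub>L adj_op A) y)" "M 2 1 = cinner z (dual_map \<Psi> S (adj_op A y))"
    using S by (simp_all add: M_def x_def X_def id_right)
  have sum3: "(\<Sum>j<3. f j) = f 0 + f 1 + f 2" for f :: "nat \<Rightarrow> complex"
    by (simp add: numeral_3_eq_3 numeral_2_eq_2)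
  have null: "(\<Sum>i<3. \<Sum>j<3. cnj (c i) * c j * M i j) = 0"
    by (simp add: sum3 c_def M del: One_nat_def)
  have "(\<Sum>j<3. M 2 j * c j) = 0"
    by (rule psd_null_vector[OF psd null]) simp
  then show "cinner z (dual_map \<Psi> (S o\<^sub>L adj_op A) y) = cinner z ((dual_map \<Psi> S o\<^sub>L adj_op A) y)"
    by (simp add: sum3 c_def M2 del: One_nat_def)
qed

lemma dual_map_left_multiplicative:
  assumes qo: "quantum_operation \<Psi>" and A: "A \<in> bounded_ops" and S: "S \<in> bounded_ops"
    and fixA: "dual_map \<Psi> A = A" "dual_map \<Psi> (A o\<^sub>L adj_op A) = A o\<^sub>L adj_op A"
  shows "dual_map \<Psi> (A o\<^sub>L S) = A o\<^sub>L dual_map \<Psi> S"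
proof -
  note ops = A S adj_op_in[OF A] adj_op_in[OF S] bounded_ops_compose[OF A S]
  have "adj_op (dual_map \<Psi> (A o\<^sub>L S)) = dual_map \<Psi> (adj_op S o\<^sub>L adj_op A)"
    using ops by (simp add: dual_map_adj[OF qo, symmetric] adj_compose)
  also have "\<dots> = dual_map \<Psi> (adj_op S) o\<^sub>L adj_op A"
    by (rule dual_map_right_multiplicative[OF qo A adj_op_in[OF S] fixA])
  also have "\<dots> = adj_op (A o\<^sub>L dual_map \<Psi> S)"
    using ops by (simp add: dual_map_adj[OF qo] adj_compose dual_map_in[OF qo])
  finally show ?thesis
    by (metis adj_adj bounded_ops_compose dual_map_in[OF qo] ops)
qed


section \<open>Constants, fixed points and commutators\<close>

lemma qo_funpow_trace_class:
  "quantum_operation \<Psi> \<Longrightarrow> T \<in> trace_class \<Longrightarrow> (\<Psi> ^^ n) T \<in> trace_class"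
  by (induction n) (auto intro: qo_trace_class)

text \<open>
  Pure states already determine an operator, because an operator on a complex space is determined by
  its quadratic form on unit vectors.
\<close>

lemma states_separate:
  assumes X: "X \<in> bounded_ops" and Y: "Y \<in> bounded_ops"
    and eq: "\<And>\<rho>. \<rho> \<in> states \<Longrightarrow> op_trace (\<rho> o\<^sub>L X) = op_trace (\<rho> o\<^sub>L Y)"
  shows "X = Y"
proof (rule bounded_ops_eqI)
  have unit: "cinner u (X u) = cinner u (Y u)" if "norm u = 1" for u
  proof -
    have "rank_one u u \<in> states"
      using that by (simp add: states_def rank_one_trace_class positive_rank_one op_trace_rank_one cinner_self)
    then show ?thesis using eq[of "rank_one u u"] by (simp add: op_trace_rank_one_compose X Y)
  qed
  define b where "b x y = cinner x (X y) - cinner x (Y y)" for x y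
  have quad: "b z z = 0" for z
  proof (cases "z = 0")
    case False
    define u where "u = inverse (norm z) *\<^sub>R z"
    have "norm u = 1" "z = norm z *\<^sub>R u" using False by (simp_all add: u_def)
    then show ?thesis
      using unit[of u] by (metis (no_types, lifting) b_def blinfun.scaleR_right cinner_scaleR_left
          cinner_scaleR_right eq_iff_diff_eq_0)
  qed (simp add: b_def)
  fix x y
  have "4 * b x y = b (x + y) (x + y) - b (x + (-1) *\<^sub>C y) (x + (-1) *\<^sub>C y)
     - \<i> * b (x + \<i> *\<^sub>C y) (x + \<i> *\<^sub>C y) + \<i> * b (x + (-\<i>) *\<^sub>C y) (x + (-\<i>) *\<^sub>C y)"
    by (simp add: b_def cinner_simps blinfun.add_right blinfun.diff_right
        bounded_ops_scaleC[OF X] bounded_ops_scaleC[OF Y] algebra_simps)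
  then show "cinner x (X y) = cinner x (Y y)" unfolding quad by (simp add: b_def)
qed

lemma is_constant_of_iff_fixed:
  assumes qo: "quantum_operation \<Psi>" and B: "B \<in> bounded_ops"
  shows "is_constant_of B \<Psi> \<longleftrightarrow> dual_map \<Psi> B = B"
proof
  assume const: "is_constant_of B \<Psi>"
  show "dual_map \<Psi> B = B"
  proof (rule states_separate[OF dual_map_in[OF qo B] B])
    fix \<rho> :: "'a \<Rightarrow>\<^sub>L 'a" assume \<rho>: "\<rho> \<in> states"
    then have "op_trace ((\<Psi> ^^ 1) \<rho> o\<^sub>L B) = op_trace ((\<Psi> ^^ 0) \<rho> o\<^sub>L B)"
      using const unfolding is_constant_of_def by blast
    then show "op_trace (\<rho> o\<^sub>L dual_map \<Psi> B) = op_trace (\<rho> o\<^sub>L B)"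
      using \<rho> by (simp add: states_def op_trace_dual_map[OF qo B])
  qed
next
  assume fixed: "dual_map \<Psi> B = B"
  have "op_trace ((\<Psi> ^^ n) \<rho> o\<^sub>L B) = op_trace (\<rho> o\<^sub>L B)" if "\<rho> \<in> trace_class" for \<rho> n
    using that
    by (induction n) (simp_all add: op_trace_dual_map[OF qo B] qo_funpow_trace_class[OF qo] fixed)
  then show "is_constant_of B \<Psi>" using B by (simp add: is_constant_of_def states_def)
qed

lemma compose_assoc: "(F o\<^sub>L G) o\<^sub>L H = F o\<^sub>L (G o\<^sub>L H)"
  by (intro blinfun_eqI) simp

text \<open>The two commutation relations are transposes of each other under the trace pairing.\<close>

lemma commutator_duality:
  assumes qo: "quantum_operation \<Psi>" and A: "A \<in> bounded_ops"
  shows "(\<forall>T\<in>trace_class. \<Psi> (T o\<^sub>L A) = \<Psi> T o\<^sub>L A)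
    \<longleftrightarrow> (\<forall>S\<in>bounded_ops. dual_map \<Psi> (A o\<^sub>L S) = A o\<^sub>L dual_map \<Psi> S)"
proof -
  have pair1: "op_trace (\<Psi> (T o\<^sub>L A) o\<^sub>L S) = op_trace (T o\<^sub>L (A o\<^sub>L dual_map \<Psi> S))"
    if "T \<in> trace_class" "S \<in> bounded_ops" for T S
    using that A by (simp add: op_trace_dual_map[OF qo] trace_class_compose_right compose_assoc)
  have pair2: "op_trace ((\<Psi> T o\<^sub>L A) o\<^sub>L S) = op_trace (T o\<^sub>L dual_map \<Psi> (A o\<^sub>L S))"
    if "T \<in> trace_class" "S \<in> bounded_ops" for T S
    using that A by (simp add: op_trace_dual_map[OF qo] compose_assoc bounded_ops_compose)
  show ?thesis
  proof (intro iffI ballI)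
    fix S :: "'a \<Rightarrow>\<^sub>L 'a"
    assume "\<forall>T\<in>trace_class. \<Psi> (T o\<^sub>L A) = \<Psi> T o\<^sub>L A" and S: "S \<in> bounded_ops"
    then show "dual_map \<Psi> (A o\<^sub>L S) = A o\<^sub>L dual_map \<Psi> S"
      using A by (intro trace_separates_bounded bounded_ops_compose dual_map_in[OF qo])
        (simp_all add: pair1[symmetric] pair2[symmetric])
  next
    fix T :: "'a \<Rightarrow>\<^sub>L 'a"
    assume "\<forall>S\<in>bounded_ops. dual_map \<Psi> (A o\<^sub>L S) = A o\<^sub>L dual_map \<Psi> S" and T: "T \<in> trace_class"
    then show "\<Psi> (T o\<^sub>L A) = \<Psi> T o\<^sub>L A"
      using A by (intro trace_separates_trace_class trace_class_compose_right qo_trace_class[OF qo])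
        (simp_all add: pair1 pair2)
  qed
qed

lemma left_commutation_iff_fixed:
  assumes qo: "quantum_operation \<Psi>" and A: "A \<in> bounded_ops"
  shows "(\<forall>S\<in>bounded_ops. dual_map \<Psi> (A o\<^sub>L S) = A o\<^sub>L dual_map \<Psi> S)
    \<longleftrightarrow> dual_map \<Psi> A = A \<and> dual_map \<Psi> (A o\<^sub>L adj_op A) = A o\<^sub>L adj_op A"
proof (intro iffI conjI ballI)
  assume com: "\<forall>S\<in>bounded_ops. dual_map \<Psi> (A o\<^sub>L S) = A o\<^sub>L dual_map \<Psi> S"
  have id_right: "A o\<^sub>L id_blinfun = A" by (intro blinfun_eqI) simp
  show fixA: "dual_map \<Psi> A = A"
    using com[rule_format, of id_blinfun] by (simp add: bounded_ops_id id_right dual_map_id[OF qo])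
  show "dual_map \<Psi> (A o\<^sub>L adj_op A) = A o\<^sub>L adj_op A"
    using com A by (simp add: adj_op_in dual_map_adj[OF qo] fixA)
qed (use dual_map_left_multiplicative[OF qo A] in blast)

theorem theorem5p2:
  fixes \<Psi> :: "('a::complex_hilbert \<Rightarrow>\<^sub>L 'a) \<Rightarrow> ('a \<Rightarrow>\<^sub>L 'a)"
    and A :: "'a \<Rightarrow>\<^sub>L 'a"
  assumes "quantum_operation \<Psi>"
    and "A \<in> bounded_ops"
  shows "((\<forall>T\<in>trace_class. commutator (right_mult A) \<Psi> T = 0)
            \<longleftrightarrow> is_constant_of A \<Psi> \<and> is_constant_of (A o\<^sub>L adj_op A) \<Psi>)
       \<and> (is_constant_of A \<Psi> \<and> is_constant_of (A o\<^sub>L adj_op A) \<Psi>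
            \<longleftrightarrow> (\<forall>S\<in>bounded_ops. commutator (left_mult A) (dual_map \<Psi>) S = 0))
       \<and> ((\<forall>S\<in>bounded_ops. commutator (left_mult A) (dual_map \<Psi>) S = 0)
            \<longleftrightarrow> dual_map \<Psi> A = A \<and> dual_map \<Psi> (A o\<^sub>L adj_op A) = A o\<^sub>L adj_op A)"
proof -
  have i: "(\<forall>T\<in>trace_class. commutator (right_mult A) \<Psi> T = 0)
      \<longleftrightarrow> (\<forall>T\<in>trace_class. \<Psi> (T o\<^sub>L A) = \<Psi> T o\<^sub>L A)"
    unfolding commutator_def right_mult_def right_minus_eq by (simp only: eq_commute)
  have iii: "(\<forall>S\<in>bounded_ops. commutator (left_mult A) (dual_map \<Psi>) S = 0)
      \<longleftrightarrow> (\<forall>S\<in>bounded_ops. dual_map \<Psi> (A o\<^sub>L S) = A o\<^sub>L dual_map \<Psi> S)"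
    unfolding commutator_def left_mult_def right_minus_eq by (simp only: eq_commute)
  have "A o\<^sub>L adj_op A \<in> bounded_ops" using assms(2) by blast
  then show ?thesis
    unfolding i iii commutator_duality[OF assms] left_commutation_iff_fixed[OF assms]
    using is_constant_of_iff_fixed[OF assms(1)] assms(2) by simp
qed

end
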